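(* Let $\mathcal E:=\mathbb C\setminus\{(-\infty,-1]\cup[1,+\infty)\}$, let $\mathfrak M$, $H$ be Hilbert spaces and let $$\mathbf K=\begin{bmatrix} K_{11} & K_{12} \\ K_{12}^* & K_{22} \end{bmatrix}:\mathfrak M\oplus H\to\mathfrak M\oplus H$$ be a selfadjoint contraction. Then: 1) If $\|K_{22}\|<1$, then for every $\Omega\in\mathcal{RS}(H)$ the transform $$\Theta(z):=K_{11}+K_{12}\Omega(z)(I-K_{22}\Omega(z))^{-1}K_{12}^*,\qquad z\in\mathcal E,$$ belongs to $\mathcal{RS}(\mathfrak M)$. 2) If $\Omega\in\mathcal{RS}(H)$ and $\Omega(0)=0$, then again the transform $\Theta$ defined by the same formula belongs to $\mathcal{RS}(\mathfrak M)$.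
   Context: Hilbert spaces are complex and separable. A $\mathbf B(\mathfrak M)$-valued function $M$ is a Nevanlinna function if it is holomorphic outside the real axis, $M(\lambda)^*=M(\bar\lambda)$, and $\operatorname{Im}\lambda\,\operatorname{Im}M(\lambda)\ge0$ for all $\lambda\in\mathbb C\setminus\mathbb R$. The class $\mathcal{RS}(\mathfrak M)$ consists of all $\mathbf B(\mathfrak M)$-valued Nevanlinna functions $\Omega$ which are holomorphic on $\mathcal E$ and satisfy $-I\le\Omega(x)\le I$ for all $x\in(-1,1)$; $\mathcal{RS}(H)$ is defined in the same way with $H$ in place of $\mathfrak M$. The claims include that $I-K_{22}\Omega(z)$ has a bounded everywhere defined inverse for all $z\in\mathcal E$. *)

theory Defs
  imports "HOL-Analysis.Analysis"
begin

section \<open>Complex Hilbert spaces\<close>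

class complex_vector = real_vector +
  fixes scaleC :: "complex \<Rightarrow> 'a \<Rightarrow> 'a"  (infixr "*\<^sub>C" 75)
  assumes scaleC_add_right: "c *\<^sub>C (x + y) = c *\<^sub>C x + c *\<^sub>C y"
    and scaleC_add_left: "(c + d) *\<^sub>C x = c *\<^sub>C x + d *\<^sub>C x"
    and scaleC_scaleC: "c *\<^sub>C d *\<^sub>C x = (c * d) *\<^sub>C x"
    and scaleR_scaleC: "r *\<^sub>R x = complex_of_real r *\<^sub>C x"

text \<open>
  The inner product is linear in the first argument. The library's \<^class>\<open>real_inner\<close> supplies
  positivity and the norm through \<open>inner_eq_Re_cinner\<close>; see \<open>norm_eq_sqrt_cinner\<close> below.
\<close>

class complex_inner = complex_vector + real_inner +
  fixes cinner :: "'a \<Rightarrow> 'a \<Rightarrow> complex"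
  assumes cinner_commute: "cinner x y = cnj (cinner y x)"
    and cinner_add_left: "cinner (x + y) z = cinner x z + cinner y z"
    and cinner_scaleC_left: "cinner (c *\<^sub>C x) y = c * cinner x y"
    and inner_eq_Re_cinner: "inner x y = Re (cinner x y)"

text \<open>For metric spaces, second countability is the same as separability.\<close>

class separable_chilbert_space = complex_inner + complete_space + second_countable_topology

lemma cinner_self: "cinner x x = complex_of_real ((norm x)\<^sup>2)"
  for x :: "'a::complex_inner"
proof -
  have "Im (cinner x x) = 0"
    using arg_cong[OF cinner_commute[of x x], of Im] by simp
  moreover have "Re (cinner x x) = (norm x)\<^sup>2"
    by (simp add: power2_norm_eq_inner inner_eq_Re_cinner)
  ultimately show ?thesis
    by (simp add: complex_eq_iff)
qed

lemma norm_eq_sqrt_cinner: "norm x = sqrt (Re (cinner x x))"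
  for x :: "'a::complex_inner"
  by (simp add: cinner_self)

lemma cinner_add_right: "cinner x (y + z) = cinner x y + cinner x z"
  for x :: "'a::complex_inner"
  by (metis cinner_add_left cinner_commute complex_cnj_add)

lemma cinner_scaleC_right: "cinner x (c *\<^sub>C y) = cnj c * cinner x y"
  for x :: "'a::complex_inner"
  by (metis cinner_commute cinner_scaleC_left complex_cnj_mult)

lemma norm_scaleC: "norm (c *\<^sub>C x) = norm c * norm x"
  for x :: "'a::complex_inner"
proof -
  have "cnj c * c = (complex_of_real (norm c))\<^sup>2"
    using complex_norm_square[of c] by (simp add: mult.commute)
  then have "complex_of_real ((norm (c *\<^sub>C x))\<^sup>2) = complex_of_real ((norm c * norm x)\<^sup>2)"
    unfolding cinner_self[symmetric] cinner_scaleC_left cinner_scaleC_right mult.assoc[symmetric]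
    by (simp add: cinner_self power_mult_distrib mult.commute)
  then have "(norm (c *\<^sub>C x))\<^sup>2 = (norm c * norm x)\<^sup>2"
    using of_real_eq_iff by blast
  then show ?thesis
    by (simp add: power2_eq_iff_nonneg)
qed

text \<open>The orthogonal sum of two Hilbert spaces; the library norm on pairs is the Hilbert one.\<close>

instantiation prod :: (complex_vector, complex_vector) complex_vector
begin

definition scaleC_prod_def: "c *\<^sub>C p = (c *\<^sub>C fst p, c *\<^sub>C snd p)"

instance
  by standard
    (auto simp: scaleC_prod_def scaleC_add_right scaleC_add_left scaleC_scaleC scaleR_scaleC prod_eq_iff)

end

instantiation prod :: (complex_inner, complex_inner) complex_inner
begin

definition cinner_prod_def: "cinner p q = cinner (fst p) (fst q) + cinner (snd p) (snd q)"

instance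
proof
  fix x y :: "'a \<times> 'b"
  have "cinner (fst x) (fst y) = cnj (cinner (fst y) (fst x))"
    and "cinner (snd x) (snd y) = cnj (cinner (snd y) (snd x))"
    by (rule cinner_commute)+
  then show "cinner x y = cnj (cinner y x)"
    unfolding cinner_prod_def complex_cnj_add by (rule arg_cong2)
qed (auto simp: cinner_prod_def cinner_add_left cinner_scaleC_left scaleC_prod_def inner_prod_def
    inner_eq_Re_cinner algebra_simps)

end

instance prod :: (separable_chilbert_space, separable_chilbert_space) separable_chilbert_space ..


section \<open>Bounded operators\<close>

text \<open>
  Elements of the library type \<^typ>\<open>'a \<Rightarrow>\<^sub>L 'b\<close> are bounded and real-linear, with the operator norm;
  the operators of the theory are those which are complex-linear.
\<close>

definition clinear_op :: "('a::complex_inner \<Rightarrow>\<^sub>L 'b::complex_inner) \<Rightarrow> bool" where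
  "clinear_op A \<longleftrightarrow> (\<forall>c x. blinfun_apply A (c *\<^sub>C x) = c *\<^sub>C blinfun_apply A x)"

instantiation blinfun :: (real_normed_vector, complex_inner) complex_vector
begin

lift_definition scaleC_blinfun :: "complex \<Rightarrow> ('a \<Rightarrow>\<^sub>L 'b) \<Rightarrow> ('a \<Rightarrow>\<^sub>L 'b)"
  is "\<lambda>c A x. c *\<^sub>C A x"
proof -
  fix c :: complex and A :: "'a \<Rightarrow> 'b"
  assume A: "bounded_linear A"
  interpret bounded_linear A by (rule A)
  have "bounded_linear (\<lambda>x. c *\<^sub>C x :: 'b)"
    by (rule bounded_linear_intro[where K = "norm c"])
      (auto simp: scaleC_add_right scaleR_scaleC scaleC_scaleC norm_scaleC mult.commute)
  then show "bounded_linear (\<lambda>x. c *\<^sub>C A x)"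
    using A by (rule bounded_linear_compose)
qed

instance
  by standard
    (transfer, auto simp: scaleC_add_right scaleC_add_left scaleC_scaleC scaleR_scaleC)+

end

definition cadjoint :: "('a::complex_inner \<Rightarrow>\<^sub>L 'b::complex_inner) \<Rightarrow> ('b \<Rightarrow>\<^sub>L 'a)" where
  "cadjoint A = (THE B. \<forall>x y. cinner (blinfun_apply A x) y = cinner x (blinfun_apply B y))"

definition selfadjoint :: "('a::complex_inner \<Rightarrow>\<^sub>L 'a) \<Rightarrow> bool" where
  "selfadjoint A \<longleftrightarrow> cadjoint A = A"

definition nonneg_op :: "('a::complex_inner \<Rightarrow>\<^sub>L 'a) \<Rightarrow> bool" where
  "nonneg_op A \<longleftrightarrow> (\<forall>x. cinner (blinfun_apply A x) x \<in> \<real> \<and> 0 \<le> Re (cinner (blinfun_apply A x) x))"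

definition op_le :: "('a::complex_inner \<Rightarrow>\<^sub>L 'a) \<Rightarrow> ('a \<Rightarrow>\<^sub>L 'a) \<Rightarrow> bool" where
  "op_le A B \<longleftrightarrow> nonneg_op (B - A)"

definition op_Im :: "('a::complex_inner \<Rightarrow>\<^sub>L 'a) \<Rightarrow> ('a \<Rightarrow>\<^sub>L 'a)" where
  "op_Im A = (1 / (2 * \<i>)) *\<^sub>C (A - cadjoint A)"

definition is_op_inverse :: "('a::complex_inner \<Rightarrow>\<^sub>L 'a) \<Rightarrow> ('a \<Rightarrow>\<^sub>L 'a) \<Rightarrow> bool" where
  "is_op_inverse A B \<longleftrightarrow> clinear_op B \<and> A o\<^sub>L B = id_blinfun \<and> B o\<^sub>L A = id_blinfun"

definition bounded_invertible :: "('a::complex_inner \<Rightarrow>\<^sub>L 'a) \<Rightarrow> bool" where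
  "bounded_invertible A \<longleftrightarrow> (\<exists>B. is_op_inverse A B)"

definition op_inverse :: "('a::complex_inner \<Rightarrow>\<^sub>L 'a) \<Rightarrow> ('a \<Rightarrow>\<^sub>L 'a)" where
  "op_inverse A = (THE B. is_op_inverse A B)"

text \<open>The block operator with rows \<open>A\<close>, \<open>B\<close> and \<open>C\<close>, \<open>D\<close>.\<close>

definition block_op ::
  "('m::complex_inner \<Rightarrow>\<^sub>L 'm) \<Rightarrow> ('h::complex_inner \<Rightarrow>\<^sub>L 'm) \<Rightarrow> ('m \<Rightarrow>\<^sub>L 'h) \<Rightarrow> ('h \<Rightarrow>\<^sub>L 'h)
    \<Rightarrow> (('m \<times> 'h) \<Rightarrow>\<^sub>L ('m \<times> 'h))" where
  "block_op A B C D = Blinfun (\<lambda>(x, y).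
    (blinfun_apply A x + blinfun_apply B y, blinfun_apply C x + blinfun_apply D y))"

lemma block_op_apply:
  "blinfun_apply (block_op A B C D) (x, y) =
    (blinfun_apply A x + blinfun_apply B y, blinfun_apply C x + blinfun_apply D y)"
proof -
  have "bounded_linear (\<lambda>p. (blinfun_apply A (fst p) + blinfun_apply B (snd p),
      blinfun_apply C (fst p) + blinfun_apply D (snd p)))"
    by (intro bounded_linear_Pair bounded_linear_add
        bounded_linear_compose[OF blinfun.bounded_linear_right]
        bounded_linear_fst bounded_linear_snd)
  then show ?thesis
    by (simp add: block_op_def bounded_linear_Blinfun_apply case_prod_unfold)
qed


subsection \<open>Well-definedness of adjoints and inverses\<close>

lemma cinner_eqI:
  fixes x y :: "'a::complex_inner"
  assumes "\<And>z. cinner z x = cinner z y"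
  shows "x = y"
proof -
  have "inner (x - y) x = inner (x - y) y"
    by (simp add: inner_eq_Re_cinner assms)
  then have "inner (x - y) (x - y) = 0"
    by (simp add: inner_diff_right)
  then show ?thesis
    by simp
qed

lemma riesz_representation:
  fixes f :: "'a::{real_inner, complete_space} \<Rightarrow> real"
  assumes "bounded_linear f"
  shows "\<exists>u. \<forall>v. f v = inner u v"
proof -
  interpret f: bounded_linear f by (rule assms)
  define J where "J x = inner x x - 2 * f x" for x
  have low: "- (onorm f)\<^sup>2 \<le> J x" for x
  proof -
    have "f x \<le> onorm f * norm x"
      using onorm[OF assms, of x] by simp
    moreover have "0 \<le> (norm x - onorm f)\<^sup>2"
      by simp
    ultimately show ?thesis
      by (simp add: J_def power2_norm_eq_inner[symmetric] power2_eq_square algebra_simps)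
  qed
  define m where "m = (INF x. J x)"
  have bdd: "bdd_below (range J)"
    by (rule bdd_belowI2[OF low])
  have m_le: "m \<le> J x" for x
    unfolding m_def by (rule cINF_lower[OF bdd]) simp
  have "\<exists>x. J x < m + 1 / real (Suc n)" for n
    using cINF_less_iff[OF _ bdd, of "m + 1 / real (Suc n)"] by (auto simp: m_def)
  then obtain X where X: "\<And>n. J (X n) < m + 1 / real (Suc n)"
    by metis
  have par: "(dist x y)\<^sup>2 \<le> 2 * (J x + J y - 2 * m)" for x y
  proof -
    have "J x + J y - 2 * J ((1/2) *\<^sub>R (x + y)) = (dist x y)\<^sup>2 / 2"
      by (simp add: J_def dist_norm power2_norm_eq_inner inner_add_left inner_add_right
          inner_diff_left inner_diff_right f.add f.scaleR inner_commute field_simps)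
    then show ?thesis
      using m_le[of "(1/2) *\<^sub>R (x + y)"] by simp
  qed
  have "Cauchy X"
  proof (rule metric_CauchyI)
    fix e :: real
    assume "0 < e"
    then obtain N where N: "1 / real (Suc N) < e\<^sup>2 / 4"
      by (metis nat_approx_posE zero_less_divide_iff zero_less_numeral zero_less_power)
    show "\<exists>M. \<forall>i\<ge>M. \<forall>j\<ge>M. dist (X i) (X j) < e"
    proof (intro exI[of _ N] allI impI)
      fix i j
      assume "N \<le> i" "N \<le> j"
      have "J (X k) < m + e\<^sup>2 / 4" if "N \<le> k" for k
      proof -
        have "1 / real (Suc k) \<le> 1 / real (Suc N)"
          using that by (intro divide_left_mono) auto
        then have "m + 1 / real (Suc k) < m + e\<^sup>2 / 4"
          using N by (metis add_strict_left_mono order.strict_trans1)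
        then show ?thesis
          using X[of k] by (rule order.strict_trans[rotated])
      qed
      from this[OF \<open>N \<le> i\<close>] this[OF \<open>N \<le> j\<close>] have "(dist (X i) (X j))\<^sup>2 < e\<^sup>2"
        using par[of "X i" "X j"] by argo
      then show "dist (X i) (X j) < e"
        using \<open>0 < e\<close> by (simp add: power_less_imp_less_base)
    qed
  qed
  then obtain u where u: "X \<longlonglongrightarrow> u"
    by (auto simp: Cauchy_convergent_iff convergent_def)
  have "(\<lambda>n. J (X n)) \<longlonglongrightarrow> J u"
    unfolding J_def by (intro tendsto_intros f.tendsto u)
  moreover have "(\<lambda>n. m + 1 / real (Suc n)) \<longlonglongrightarrow> m + 0"
    by (intro tendsto_intros LIMSEQ_Suc[OF lim_1_over_n])
  ultimately have Ju: "J u \<le> m"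
    using X by (intro LIMSEQ_le[of "\<lambda>n. J (X n)" "J u" _ m]) (auto intro: less_imp_le)
  have "f v = inner u v" for v
  proof (cases "v = 0")
    case False
    define a where "a = inner u v - f v"
    define t where "t = - a / inner v v"
    have v: "inner v v > 0"
      using False by simp
    have "J (u + t *\<^sub>R v) = J u + t * t * inner v v + 2 * t * a"
      by (simp add: J_def a_def inner_add_left inner_add_right f.add f.scaleR inner_commute
          algebra_simps)
    then have "0 \<le> t * t * inner v v + 2 * t * a"
      using m_le[of "u + t *\<^sub>R v"] Ju by simp
    also have "\<dots> = - (a * a) / inner v v"
      using v by (simp add: t_def field_simps)
    finally have "a = 0"
      using v by (smt (verit) divide_nonneg_pos divide_eq_0_iff mult_eq_0_iff minus_divide_left zero_le_square)
    then show ?thesis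
      by (simp add: a_def)
  qed (simp add: f.zero)
  then show ?thesis
    by blast
qed

lemma cadjoint_exists:
  fixes A :: "'a::{complex_inner, complete_space} \<Rightarrow>\<^sub>L 'b::complex_inner"
  assumes "clinear_op A"
  shows "\<exists>B. \<forall>x y. cinner (blinfun_apply A x) y = cinner x (blinfun_apply B y)"
proof -
  have "\<exists>u. \<forall>x. inner (blinfun_apply A x) y = inner u x" for y
    by (intro riesz_representation bounded_linear_compose[OF bounded_linear_inner_left]
        blinfun.bounded_linear_right)
  then obtain B where "\<And>x y. inner (blinfun_apply A x) y = inner (B y) x"
    by metis
  then have B: "\<And>x y. inner x (B y) = inner (blinfun_apply A x) y"
    by (simp add: inner_commute)
  have eqI: "u = v" if "\<And>x. inner x u = inner x v" for u v :: 'a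
    using that by (metis vector_eq_ldot)
  have "bounded_linear B"
  proof (rule bounded_linear_intro[where K = "norm A"])
    show "B (x + y) = B x + B y" for x y
      by (rule eqI) (simp add: B inner_add_right)
    show "B (r *\<^sub>R x) = r *\<^sub>R B x" for r x
      by (rule eqI) (simp add: B)
    show "norm (B x) \<le> norm x * norm A" for x
    proof (cases "B x = 0")
      case False
      have "norm (B x) * norm (B x) = inner (blinfun_apply A (B x)) x"
        by (simp add: B[symmetric] power2_norm_eq_inner[symmetric] power2_eq_square)
      also have "\<dots> \<le> norm A * norm (B x) * norm x"
        by (meson norm_blinfun norm_cauchy_schwarz norm_ge_zero mult_right_mono order_trans)
      finally have "norm (B x) * norm (B x) \<le> norm (B x) * (norm x * norm A)"
        by (simp add: mult_ac)
      then show ?thesis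
        using False by simp
    qed simp
  qed
  then have app: "blinfun_apply (Blinfun B) = B"
    by (rule bounded_linear_Blinfun_apply)
  have "cinner (blinfun_apply A x) y = cinner x (B y)" for x y
  proof (rule complex_eqI)
    show "Re (cinner (blinfun_apply A x) y) = Re (cinner x (B y))"
      by (simp add: inner_eq_Re_cinner[symmetric] B)
    have "Re (cinner (blinfun_apply A ((- \<i>) *\<^sub>C x)) y) = Re (cinner ((- \<i>) *\<^sub>C x) (B y))"
      unfolding inner_eq_Re_cinner[symmetric] B ..
    then show "Im (cinner (blinfun_apply A x) y) = Im (cinner x (B y))"
      using assms by (simp add: clinear_op_def cinner_scaleC_left del: scaleC_add_right)
  qed
  then show ?thesis
    using app by metis
qed

lemma cadjoint_cinner:
  fixes A :: "'a::{complex_inner, complete_space} \<Rightarrow>\<^sub>L 'b::complex_inner"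
  assumes "clinear_op A"
  shows "cinner (blinfun_apply A x) y = cinner x (blinfun_apply (cadjoint A) y)"
proof -
  obtain B where B: "\<forall>x y. cinner (blinfun_apply A x) y = cinner x (blinfun_apply B y)"
    using cadjoint_exists[OF assms] by blast
  have "\<forall>x y. cinner (blinfun_apply A x) y = cinner x (blinfun_apply (cadjoint A) y)"
    unfolding cadjoint_def
  proof (rule theI[of _ B])
    show "C = B" if "\<forall>x y. cinner (blinfun_apply A x) y = cinner x (blinfun_apply C y)" for C
      using B that by (intro blinfun_eqI cinner_eqI) metis
  qed (rule B)
  then show ?thesis
    by blast
qed

lemma op_inverse_eqI:
  assumes "is_op_inverse A B"
  shows "op_inverse A = B"
  unfolding op_inverse_def
proof (rule the_equality[where P = "is_op_inverse A", OF assms])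
  fix C
  assume "is_op_inverse A C"
  then have "C = (C o\<^sub>L A) o\<^sub>L B"
    using assms unfolding is_op_inverse_def
    by (metis blinfun_apply_blinfun_compose blinfun_apply_id_blinfun blinfun_eqI)
  also have "\<dots> = B"
    using \<open>is_op_inverse A C\<close> unfolding is_op_inverse_def
    by (simp add: blinfun_eqI)
  finally show "C = B" .
qed


section \<open>Operator-valued Nevanlinna functions\<close>

text \<open>
  Complex differentiability in operator norm: the analogue of \<^const>\<open>has_field_derivative\<close>, which
  is not available for values in \<^typ>\<open>'a \<Rightarrow>\<^sub>L 'b\<close>. The derivative \<open>D\<close>, as a norm limit of
  complex-linear operators, is itself complex-linear.
\<close>

definition op_holomorphic_on ::
  "(complex \<Rightarrow> ('a::complex_inner \<Rightarrow>\<^sub>L 'b::complex_inner)) \<Rightarrow> complex set \<Rightarrow> bool" where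
  "op_holomorphic_on F S \<longleftrightarrow>
    (\<forall>z\<in>S. clinear_op (F z)) \<and>
    (\<forall>z\<in>S. \<exists>D. (F has_derivative (\<lambda>h. h *\<^sub>C D)) (at z within S))"

definition nevanlinna :: "(complex \<Rightarrow> ('a::complex_inner \<Rightarrow>\<^sub>L 'a)) \<Rightarrow> bool" where
  "nevanlinna F \<longleftrightarrow>
    op_holomorphic_on F (- \<real>) \<and>
    (\<forall>z\<in>- \<real>. cadjoint (F z) = F (cnj z)) \<and>
    (\<forall>z\<in>- \<real>. nonneg_op (Im z *\<^sub>R op_Im (F z)))"

definition cut_plane :: "complex set" where
  "cut_plane = - (complex_of_real ` ({..-1} \<union> {1..}))"

text \<open>
  Functions are total in HOL: membership only restricts the values on \<open>cut_plane\<close>, the domain of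
  definition.
\<close>

definition RS :: "(complex \<Rightarrow> ('a::complex_inner \<Rightarrow>\<^sub>L 'a)) set" where
  "RS = {F. nevanlinna F \<and> op_holomorphic_on F cut_plane \<and>
    (\<forall>x\<in>{-1<..<1}. op_le (- id_blinfun) (F (complex_of_real x)) \<and>
      op_le (F (complex_of_real x)) id_blinfun)}"

definition Theta_transform ::
  "('m::complex_inner \<Rightarrow>\<^sub>L 'm) \<Rightarrow> ('h::complex_inner \<Rightarrow>\<^sub>L 'm) \<Rightarrow> ('h \<Rightarrow>\<^sub>L 'h)
    \<Rightarrow> (complex \<Rightarrow> ('h \<Rightarrow>\<^sub>L 'h)) \<Rightarrow> complex \<Rightarrow> ('m \<Rightarrow>\<^sub>L 'm)" where
  "Theta_transform K11 K12 K22 F z =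
    K11 + (K12 o\<^sub>L F z o\<^sub>L op_inverse (id_blinfun - (K22 o\<^sub>L F z)) o\<^sub>L cadjoint K12)"

end

theory Submission
  imports Defs "HOL-Complex_Analysis.Conformal_Mappings"
begin

text \<open>
  The scalar functions \<open>f z = (\<Omega> z h, h)\<close> map the upper half plane into its closure, and the
  Schwarz--Pick inequality yields \<open>\<bar>f z - f w\<bar> \<le> C \<bar>Im (f z)\<bar>\<close> with \<open>C\<close> depending only on \<open>z\<close> and \<open>w\<close>.
  If \<open>h - K\<^sub>2\<^sub>2 \<Omega> z h\<close> is small, then so is \<open>Im (\<Omega> z h, h)\<close>, because \<open>K\<^sub>2\<^sub>2\<close> is selfadjoint; by
  polarization \<open>(\<Omega> z - \<Omega> w) h\<close> is small, and so is \<open>h - K\<^sub>2\<^sub>2 \<Omega> w h\<close>. For \<open>w\<close> close to \<open>0\<close> this forces \<open>h\<close>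
  to be small, as \<open>\<parallel>K\<^sub>2\<^sub>2\<parallel> \<parallel>\<Omega> 0\<parallel> < 1\<close>. Hence \<open>I - K\<^sub>2\<^sub>2 \<Omega> z\<close> and its adjoint are bounded below. On \<open>(-1, 1)\<close> one
  needs \<open>\<parallel>K\<^sub>2\<^sub>2\<parallel> \<parallel>\<Omega> x\<parallel> < 1\<close>; when \<open>\<Omega> 0 = 0\<close> this comes from the boundary form of Schwarz--Pick.

  For \<open>h z = (I - K\<^sub>2\<^sub>2 \<Omega> z)\<inverse> K\<^sub>1\<^sub>2\<^sup>* m\<close> the block operator maps \<open>(m, \<Omega> z (h z))\<close> to \<open>(\<Theta> z m, h z)\<close>. Its symmetry
  and contractivity turn each property of \<open>\<Omega>\<close> into the same property of \<open>\<Theta>\<close>.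
\<close>

section \<open>The Schwarz--Pick inequality\<close>

text \<open>This identity exchanges distances for imaginary parts. It shows that \<open>a\<close> is
  nearer to \<open>b\<close> than to \<open>cnj b\<close> when both lie in the same half plane, and
  it puts the Schwarz lemma into its half-plane form.\<close>

lemma norm_diff_eq_norm_diff_cnj:
  "(cmod (a - b))\<^sup>2 = (cmod (a - cnj b))\<^sup>2 - 4 * Im a * Im b"
  unfolding cmod_power2 by (simp add: power2_eq_square algebra_simps)

text \<open>Cayley transforms centred at \<open>w\<close> and \<open>f w\<close> turn
  \<open>f\<close> into a self-map of the unit disc fixing 0, to which the Schwarz lemma
  applies.\<close>

lemma Schwarz_Pick_upper_half_plane_strict:
  assumes hol: "f holomorphic_on {z. 0 < Im z}"
    and pos: "\<And>z. 0 < Im z \<Longrightarrow> 0 < Im (f z)"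
    and z: "0 < Im z" and w: "0 < Im w"
  shows "(cmod (f z - cnj (f w)))\<^sup>2 * (Im z * Im w) \<le> (cmod (z - cnj w))\<^sup>2 * (Im (f z) * Im (f w))"
proof -
  \<comment> \<open>\<open>u\<close> is the inverse Cayley transform, mapping the unit disc to the
    upper half plane with \<open>u 0 = w\<close>. \<open>g\<close> follows \<open>f\<close> after
    \<open>u\<close> by the Cayley transform sending \<open>f w\<close> to 0.\<close>
  define u where "u t = (w - t * cnj w) / (1 - t)" for t
  define g where "g t = (f (u t) - f w) / (f (u t) - cnj (f w))" for t
  have ne1: "1 - t \<noteq> 0" if "cmod t < 1" for t
    using that by auto
  have Im_u: "0 < Im (u t)" if "cmod t < 1" for t
  proof -
    have "u t = (w - t * cnj w) * cnj (1 - t) / of_real ((cmod (1 - t))\<^sup>2)"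
      unfolding u_def by (rule complex_div_cnj)
    moreover have "Im ((w - t * cnj w) * cnj (1 - t)) = Im w * (1 - (cmod t)\<^sup>2)"
      unfolding cmod_power2 by (simp add: power2_eq_square algebra_simps)
    ultimately have "Im (u t) = Im w * (1 - (cmod t)\<^sup>2) / (cmod (1 - t))\<^sup>2"
      by (metis Im_divide_of_real)
    then show ?thesis
      using w that ne1[OF that] by (simp add: abs_square_less_1)
  qed
  have ne2: "a - cnj b \<noteq> 0" if "0 < Im a" "0 < Im b" for a b
    using that by (auto simp: complex_eq_iff)
  have "u holomorphic_on ball 0 1"
    unfolding u_def by (intro holomorphic_intros) (auto simp: ne1)
  then have "(f \<circ> u) holomorphic_on ball 0 1"
    by (rule holomorphic_on_compose_gen[OF _ hol]) (auto simp: Im_u)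
  then have hol_g: "g holomorphic_on ball 0 1"
    unfolding g_def o_def
    by (intro holomorphic_intros ne2 pos Im_u w) auto
  have u0: "g 0 = 0"
    by (simp add: g_def u_def)
  have less: "cmod (a - b) < cmod (a - cnj b)" if "0 < Im a" "0 < Im b" for a b
  proof (rule power2_less_imp_less)
    have "0 < Im a * Im b"
      using that by simp
    then show "(cmod (a - b))\<^sup>2 < (cmod (a - cnj b))\<^sup>2"
      by (simp add: norm_diff_eq_norm_diff_cnj[of a b])
  qed simp
  have g_less: "cmod (g t) < 1" if "cmod t < 1" for t
    using less[OF pos[OF Im_u[OF that]] pos[OF w]] ne2[OF pos[OF Im_u[OF that]] pos[OF w]]
    by (simp add: g_def norm_divide)
  define t where "t = (z - w) / (z - cnj w)"
  have t: "cmod t < 1"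
    using less[OF z w] ne2[OF z w] by (simp add: t_def norm_divide)
  have "u t = z"
  proof -
    have "1 - t = (w - cnj w) / (z - cnj w)" "w - t * cnj w = z * (w - cnj w) / (z - cnj w)"
      using ne2[OF z w] by (auto simp: t_def field_simps)
    then show ?thesis
      using ne2[OF z w] ne2[OF w w] by (simp add: u_def)
  qed
  have "cmod (g t) \<le> cmod t"
    by (rule Schwarz_Lemma(1)[OF hol_g u0 g_less t])
  then have "cmod (f z - f w) * cmod (z - cnj w) \<le> cmod (z - w) * cmod (f z - cnj (f w))"
    using ne2[OF z w] ne2[OF pos[OF z] pos[OF w]] \<open>u t = z\<close>
    by (simp add: g_def t_def norm_divide divide_simps)
  \<comment> \<open>After squaring and replacing each distance by its conjugate version, the product
    of the two squared conjugate distances cancels from both sides. The cross terms are the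
    claim.\<close>
  then have "(cmod (f z - f w) * cmod (z - cnj w))\<^sup>2 \<le> (cmod (z - w) * cmod (f z - cnj (f w)))\<^sup>2"
    by (rule power_mono) simp
  then show ?thesis
    unfolding power_mult_distrib norm_diff_eq_norm_diff_cnj[of "f z" "f w"] norm_diff_eq_norm_diff_cnj[of z w]
    by (simp add: algebra_simps)
qed

text \<open>Adding \<open>\<i> * of_real e\<close> pushes the values into the open half plane. The
  strict version then passes to the limit as \<open>e\<close> decreases to 0.\<close>

lemma Schwarz_Pick_upper_half_plane:
  assumes hol: "f holomorphic_on {z. 0 < Im z}"
    and pos: "\<And>z. 0 < Im z \<Longrightarrow> 0 \<le> Im (f z)"
    and z: "0 < Im z" and w: "0 < Im w"
  shows "(cmod (f z - cnj (f w)))\<^sup>2 * (Im z * Im w) \<le> (cmod (z - cnj w))\<^sup>2 * (Im (f z) * Im (f w))"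
proof -
  have "(cmod (f z + \<i> * of_real e - cnj (f w + \<i> * of_real e)))\<^sup>2 * (Im z * Im w)
      \<le> (cmod (z - cnj w))\<^sup>2 * (Im (f z + \<i> * of_real e) * Im (f w + \<i> * of_real e))" if "0 < e" for e
    using that
    by (intro Schwarz_Pick_upper_half_plane_strict[where f = "\<lambda>z. f z + \<i> * of_real e", OF _ _ z w])
      (auto intro!: holomorphic_intros hol add_nonneg_pos pos)
  moreover have "((\<lambda>e. (cmod (f z + \<i> * of_real e - cnj (f w + \<i> * of_real e)))\<^sup>2 * (Im z * Im w))
      \<longlongrightarrow> (cmod (f z + \<i> * of_real 0 - cnj (f w + \<i> * of_real 0)))\<^sup>2 * (Im z * Im w)) (at_right 0)"
    "((\<lambda>e. (cmod (z - cnj w))\<^sup>2 * (Im (f z + \<i> * of_real e) * Im (f w + \<i> * of_real e)))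
      \<longlongrightarrow> (cmod (z - cnj w))\<^sup>2 * (Im (f z + \<i> * of_real 0) * Im (f w + \<i> * of_real 0))) (at_right 0)"
    by (intro tendsto_intros)+
  ultimately show ?thesis
    by (intro tendsto_le[of "at_right (0::real)"]) (auto simp: eventually_at_right_field intro: exI[of _ 1])
qed

text \<open>The symmetry of \<open>f\<close> under conjugation carries the inequality to pairs of
  points in the lower half plane.\<close>

lemma Schwarz_Pick_off_real_axis:
  assumes hol: "f holomorphic_on - \<real>"
    and sym: "\<And>z. z \<notin> \<real> \<Longrightarrow> f (cnj z) = cnj (f z)"
    and pos: "\<And>z. z \<notin> \<real> \<Longrightarrow> 0 \<le> Im z * Im (f z)"
    and zw: "0 < Im z * Im w"
  shows "(cmod (f z - cnj (f w)))\<^sup>2 * (Im z * Im w) \<le> (cmod (z - cnj w))\<^sup>2 * (Im (f z) * Im (f w))"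
proof -
  have hol': "f holomorphic_on {z. 0 < Im z}"
    by (rule holomorphic_on_subset[OF hol]) (auto simp: complex_is_Real_iff)
  have pos': "0 \<le> Im (f z)" if "0 < Im z" for z
    using pos[of z] that by (auto simp: complex_is_Real_iff zero_le_mult_iff)
  consider "0 < Im z" "0 < Im w" | "Im z < 0" "Im w < 0"
    using zw by (auto simp: zero_less_mult_iff)
  then show ?thesis
  proof cases
    case 1
    then show ?thesis
      using Schwarz_Pick_upper_half_plane[OF hol' pos'] by blast
  next
    case 2
    then have "(cmod (cnj (f z - cnj (f w))))\<^sup>2 * (Im z * Im w)
        \<le> (cmod (cnj (z - cnj w)))\<^sup>2 * (Im (f z) * Im (f w))"
      using Schwarz_Pick_upper_half_plane[OF hol' pos', of "cnj z" "cnj w"]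
      by (simp add: sym complex_is_Real_iff)
    then show ?thesis
      unfolding complex_mod_cnj .
  qed
qed

text \<open>The constant depends on \<open>z\<close> and \<open>w\<close> but not on
  \<open>f\<close>, so one constant serves the quadratic forms of all vectors at once. Only the
  imaginary part at \<open>z\<close> appears, because that at \<open>w\<close> is controlled by
  it.\<close>

lemma norm_diff_le_Im_off_real_axis:
  assumes hol: "f holomorphic_on - \<real>"
    and sym: "\<And>z. z \<notin> \<real> \<Longrightarrow> f (cnj z) = cnj (f z)"
    and pos: "\<And>z. z \<notin> \<real> \<Longrightarrow> 0 \<le> Im z * Im (f z)"
    and zw: "0 < Im z * Im w"
  shows "cmod (f z - f w) \<le> (cmod (z - cnj w))\<^sup>2 / (Im z * Im w) * \<bar>Im (f z)\<bar>"
proof -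
  define C where "C = (cmod (z - cnj w))\<^sup>2 / (Im z * Im w)"
  have C: "0 \<le> C"
    unfolding C_def using zw by simp
  define a where "a = Im (f z)"
  define b where "b = Im (f w)"
  have nr: "z \<notin> \<real>" "w \<notin> \<real>"
    using zw by (auto simp: complex_is_Real_iff)
  have "0 \<le> (Im z * Im w) * (a * b)"
    using mult_nonneg_nonneg[OF pos[OF nr(1)] pos[OF nr(2)]] by (simp add: a_def b_def mult_ac)
  then have ab: "0 \<le> a * b"
    using zw by (simp add: zero_le_mult_iff)
  have SP: "(cmod (f z - cnj (f w)))\<^sup>2 \<le> C * (a * b)"
    using Schwarz_Pick_off_real_axis[OF hol sym pos zw] zw by (simp add: C_def a_def b_def field_simps)
  have "(a + b)\<^sup>2 \<le> (cmod (f z - cnj (f w)))\<^sup>2"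
    by (simp add: cmod_power2 a_def b_def)
  also note SP
  finally have "(a + b)\<^sup>2 \<le> C * (a * b)" .
  \<comment> \<open>As \<open>a\<close> and \<open>b\<close> do not have opposite signs,
    \<open>b * b\<close> is at most the square of \<open>a + b\<close>, hence at most
    \<open>C * (a * b)\<close>. Cancelling \<open>\<bar>b\<bar>\<close> gives a Harnack-type bound
    of \<open>b\<close> by \<open>a\<close>.\<close>
  moreover have "b * b \<le> (a + b)\<^sup>2"
    using ab by (simp add: power2_eq_square algebra_simps)
  ultimately have "\<bar>b\<bar> * \<bar>b\<bar> \<le> \<bar>b\<bar> * (C * \<bar>a\<bar>)"
    using ab by (simp add: mult_ac flip: abs_mult)
  then have b: "\<bar>b\<bar> \<le> C * \<bar>a\<bar>"
    using C by (cases "b = 0") (simp_all only: mult_le_cancel_left, auto)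
  have "(cmod (f z - f w))\<^sup>2 \<le> (cmod (f z - cnj (f w)))\<^sup>2"
    unfolding norm_diff_eq_norm_diff_cnj[of "f z" "f w"] using ab by (simp add: a_def b_def mult.assoc)
  also have "\<dots> \<le> C * (\<bar>a\<bar> * \<bar>b\<bar>)"
    using SP ab by (simp flip: abs_mult)
  also have "\<dots> \<le> C * (\<bar>a\<bar> * (C * \<bar>a\<bar>))"
    using b C by (intro mult_left_mono) auto
  also have "\<dots> = (C * \<bar>a\<bar>)\<^sup>2"
    by (simp add: power2_eq_square mult_ac)
  finally have "cmod (f z - f w) \<le> C * \<bar>a\<bar>"
    by (rule power2_le_imp_le) (simp add: C)
  then show ?thesis
    by (simp add: C_def a_def)
qed

section \<open>Bounded operators on complex Hilbert spaces\<close>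

lemma bounded_linear_scaleC_right: "bounded_linear (\<lambda>x. c *\<^sub>C x :: 'a::complex_inner)"
  by (rule bounded_linear_intro[where K = "norm c"])
    (auto simp: scaleC_add_right scaleR_scaleC scaleC_scaleC norm_scaleC mult.commute)

lemma cinner_scaleR_left: "cinner (r *\<^sub>R x) y = of_real r * cinner x (y::'a::complex_inner)"
  by (simp add: scaleR_scaleC cinner_scaleC_left)

lemma cinner_scaleR_right: "cinner x (r *\<^sub>R y) = of_real r * cinner x (y::'a::complex_inner)"
  by (simp add: scaleR_scaleC cinner_scaleC_right)

lemma scaleC_one: "1 *\<^sub>C x = (x::'a::complex_vector)"
  using scaleR_scaleC[of 1 x] by simp

lemma cinner_zero_left: "cinner 0 y = 0" for y :: "'a::complex_inner"
  using cinner_scaleR_left[of 0 0 y] by simp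

lemma cinner_zero_right: "cinner x 0 = 0" for x :: "'a::complex_inner"
  using cinner_scaleR_right[of x 0 0] by simp

lemma cinner_minus_left: "cinner (- x) y = - cinner x (y::'a::complex_inner)"
  using cinner_scaleR_left[of "-1" x y] by simp

lemma cinner_minus_right: "cinner x (- y) = - cinner x (y::'a::complex_inner)"
  using cinner_scaleR_right[of x "-1" y] by simp

lemma cinner_diff_left: "cinner (x - y) z = cinner x z - cinner y (z::'a::complex_inner)"
  using cinner_add_left[of x "- y" z] by (simp add: cinner_minus_left)

lemma cinner_diff_right: "cinner x (y - z) = cinner x y - cinner x (z::'a::complex_inner)"
  using cinner_add_right[of x y "- z"] by (simp add: cinner_minus_right)

lemmas cinner_simps = cinner_add_left cinner_add_right cinner_diff_left cinner_diff_right
  cinner_minus_left cinner_minus_right cinner_scaleR_left cinner_scaleR_right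
  cinner_scaleC_left cinner_scaleC_right

lemma norm_cinner_le: "cmod (cinner x y) \<le> norm x * norm (y::'a::complex_inner)"
proof (cases "cinner x y = 0")
  case False
  \<comment> \<open>This unimodular factor rotates the inner product onto the positive real axis, so
    that the real Cauchy-Schwarz inequality applies.\<close>
  define c where "c = cnj (sgn (cinner x y))"
  have c: "cmod c = 1" "c * cinner x y = of_real (cmod (cinner x y))"
  proof -
    show "cmod c = 1"
      using False by (simp add: c_def norm_sgn)
    have "c * cinner x y = cinner x y * cnj (cinner x y) / of_real (cmod (cinner x y))"
      by (simp add: c_def sgn_eq mult.commute)
    then show "c * cinner x y = of_real (cmod (cinner x y))"
      using False by (simp add: complex_norm_square[symmetric] power2_eq_square)
  qed
  have "cmod (cinner x y) = inner (c *\<^sub>C x) y"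
    by (simp add: inner_eq_Re_cinner cinner_scaleC_left c(2))
  also have "\<dots> \<le> norm (c *\<^sub>C x) * norm y"
    by (rule norm_cauchy_schwarz)
  finally show ?thesis
    by (simp add: norm_scaleC c(1))
qed simp

lemma bounded_linear_cinner_left: "bounded_linear (\<lambda>x. cinner x (y::'a::complex_inner))"
  by (rule bounded_linear_intro[where K = "norm y"])
    (auto simp: cinner_simps scaleR_conv_of_real norm_cinner_le)

section \<open>Complex-linear operators and their adjoints\<close>

lemma clinear_opD: "clinear_op A \<Longrightarrow> blinfun_apply A (c *\<^sub>C x) = c *\<^sub>C blinfun_apply A x"
  by (simp add: clinear_op_def)

lemma clinear_op_id: "clinear_op id_blinfun"
  by (simp add: clinear_op_def)

lemma clinear_op_compose: "clinear_op A \<Longrightarrow> clinear_op B \<Longrightarrow> clinear_op (A o\<^sub>L B)"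
  by (simp add: clinear_op_def)

lemma clinear_op_add: "clinear_op A \<Longrightarrow> clinear_op B \<Longrightarrow> clinear_op (A + B)"
  by (simp add: clinear_op_def blinfun.add_left scaleC_add_right)

lemma scaleC_diff_right: "c *\<^sub>C (x - y) = c *\<^sub>C x - c *\<^sub>C (y::'a::complex_inner)"
  using bounded_linear_scaleC_right by (rule linear_diff[OF bounded_linear.linear])

lemma clinear_op_diff: "clinear_op A \<Longrightarrow> clinear_op B \<Longrightarrow> clinear_op (A - B)"
  by (simp add: clinear_op_def blinfun.diff_left scaleC_diff_right)

lemma cadjoint_eqI:
  fixes A :: "'a::complex_inner \<Rightarrow>\<^sub>L 'b::complex_inner"
  assumes "\<And>x y. cinner (blinfun_apply A x) y = cinner x (blinfun_apply B y)"
  shows "cadjoint A = B"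
  unfolding cadjoint_def
proof (rule the_equality)
  show "C = B" if "\<forall>x y. cinner (blinfun_apply A x) y = cinner x (blinfun_apply C y)" for C
    using assms that by (intro blinfun_eqI cinner_eqI) metis
qed (use assms in blast)

lemma cadjoint_cinner_left:
  fixes A :: "'a::{complex_inner, complete_space} \<Rightarrow>\<^sub>L 'b::complex_inner"
  assumes "clinear_op A"
  shows "cinner (blinfun_apply (cadjoint A) y) x = cinner y (blinfun_apply A x)"
  by (metis cadjoint_cinner[OF assms] cinner_commute)

lemma clinear_op_cadjoint:
  fixes A :: "'a::{complex_inner, complete_space} \<Rightarrow>\<^sub>L 'b::complex_inner"
  assumes "clinear_op A"
  shows "clinear_op (cadjoint A)"
  unfolding clinear_op_def
  by (intro allI cinner_eqI) (simp add: cadjoint_cinner[OF assms, symmetric] cinner_simps)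

text \<open>Reality of the form at \<open>x + y\<close> fixes the imaginary part of
  \<open>cinner (T x) y\<close>, and reality at \<open>x + \<i> *\<^sub>C y\<close> fixes its real
  part. This recovers symmetry on the real interval, where only order bounds are prescribed.\<close>

lemma cinner_eq_if_quadratic_form_real:
  fixes T :: "'a::complex_inner \<Rightarrow>\<^sub>L 'a"
  assumes lin: "clinear_op T" and real: "\<And>h. cinner (blinfun_apply T h) h \<in> \<real>"
  shows "cinner (blinfun_apply T x) y = cinner x (blinfun_apply T y)"
proof -
  have "cinner (T (x + y)) (x + y) \<in> \<real>" "cinner (T (x + \<i> *\<^sub>C y)) (x + \<i> *\<^sub>C y) \<in> \<real>"
    "cinner (T x) x \<in> \<real>" "cinner (T y) y \<in> \<real>"
    by (rule real)+
  then have "Im (cinner (T x) y + cinner (T y) x) = 0" "Re (cinner (T x) y - cinner (T y) x) = 0"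
    by (simp_all add: complex_is_Real_iff blinfun.add_right clinear_opD[OF lin] cinner_simps)
  then have "cinner (T x) y = cnj (cinner (T y) x)"
    by (simp add: complex_eq_iff)
  then show ?thesis
    by (metis cinner_commute)
qed

text \<open>Polarization expresses \<open>cinner (T x) y\<close> through four values of the form of
  \<open>T\<close>. The dominating expression is itself a quadratic form in \<open>h\<close>, so its
  four values add up by the parallelogram law.\<close>

lemma norm_cinner_le_if_quadratic_form_le:
  fixes T W :: "'a::complex_inner \<Rightarrow>\<^sub>L 'a"
  assumes T: "clinear_op T" and W: "clinear_op W"
    and le: "\<And>h. cmod (cinner (blinfun_apply T h) h) \<le> a * Im (cinner (blinfun_apply W h) h)"
  shows "cmod (cinner (blinfun_apply T x) y)
    \<le> a * (Im (cinner (blinfun_apply W x) x) + Im (cinner (blinfun_apply W y) y))"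
proof -
  define q where "q h = cinner (T h) h" for h
  define p where "p h = a * Im (cinner (W h) h)" for h
  have q: "4 * cinner (T x) y = q (x + y) - q (x - y) + \<i> * q (x + \<i> *\<^sub>C y) - \<i> * q (x - \<i> *\<^sub>C y)"
    by (simp add: q_def blinfun.add_right blinfun.diff_right clinear_opD[OF T] cinner_simps algebra_simps)
  have p: "p (x + y) + p (x - y) + p (x + \<i> *\<^sub>C y) + p (x - \<i> *\<^sub>C y) = 4 * (p x + p y)"
    by (simp add: p_def blinfun.add_right blinfun.diff_right clinear_opD[OF W] cinner_simps algebra_simps)
  have "4 * cmod (cinner (T x) y) = cmod (4 * cinner (T x) y)"
    by (simp add: norm_mult)
  also have "\<dots> \<le> cmod (q (x + y)) + cmod (q (x - y)) + cmod (\<i> * q (x + \<i> *\<^sub>C y)) + cmod (\<i> * q (x - \<i> *\<^sub>C y))"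
    unfolding q by (smt (verit) norm_triangle_ineq norm_triangle_ineq4)
  also have "\<dots> \<le> p (x + y) + p (x - y) + p (x + \<i> *\<^sub>C y) + p (x - \<i> *\<^sub>C y)"
    unfolding norm_mult using le by (intro add_mono) (auto simp: p_def q_def)
  finally show ?thesis
    unfolding p by (simp add: p_def algebra_simps)
qed

text \<open>Let \<open>y\<close> be the positive multiple of \<open>T x\<close> that is as long as
  \<open>x\<close>. By symmetry \<open>inner (T x) y\<close> is the polarization of the form at
  \<open>x + y\<close> and \<open>x - y\<close>, and the parallelogram law bounds it by
  \<open>a\<close> times the squared norm of \<open>x\<close>.\<close>

lemma norm_le_if_quadratic_form_le:
  fixes T :: "'a::complex_inner \<Rightarrow>\<^sub>L 'a"
  assumes sym: "\<And>x y. cinner (blinfun_apply T x) y = cinner x (blinfun_apply T y)"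
    and le: "\<And>h. cmod (cinner (blinfun_apply T h) h) \<le> a * (norm h)\<^sup>2" and a: "0 \<le> a"
  shows "norm T \<le> a"
proof (rule norm_blinfun_bound[OF a])
  fix x
  define n where "n = norm (T x)"
  show "norm (T x) \<le> a * norm x"
  proof (cases "n = 0 \<or> x = 0")
    case False
    then have n: "0 < n" "0 < norm x"
      by (auto simp: n_def)
    define t where "t = norm x / n"
    define y where "y = t *\<^sub>R T x"
    have y: "norm y = norm x"
      using n by (simp add: y_def t_def n_def[symmetric])
    have "inner (T x) y = t * n\<^sup>2"
      by (simp add: y_def n_def power2_norm_eq_inner)
    then have xy: "inner (T x) y = norm x * n"
      using n by (simp add: t_def power2_eq_square)
    have "inner (T y) x = inner (T x) y"
      by (metis sym inner_eq_Re_cinner inner_commute)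
    then have "4 * inner (T x) y = inner (T (x + y)) (x + y) - inner (T (x - y)) (x - y)"
      by (simp add: blinfun.add_right blinfun.diff_right inner_add_left inner_add_right
          inner_diff_left inner_diff_right)
    also have "\<dots> \<le> a * (norm (x + y))\<^sup>2 + a * (norm (x - y))\<^sup>2"
      using le[of "x + y"] le[of "x - y"] abs_Re_le_cmod[of "cinner (T (x + y)) (x + y)"]
        abs_Re_le_cmod[of "cinner (T (x - y)) (x - y)"]
      unfolding inner_eq_Re_cinner by argo
    also have "\<dots> = 2 * a * ((norm x)\<^sup>2 + (norm y)\<^sup>2)"
      by (simp add: power2_norm_eq_inner inner_add_left inner_add_right
          inner_diff_left inner_diff_right algebra_simps)
    finally have "norm x * n \<le> norm x * (a * norm x)"
      unfolding xy y by (simp add: power2_eq_square algebra_simps)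
    then show ?thesis
      using n(2) unfolding n_def[symmetric] by (simp only: mult_le_cancel_left_pos)
  qed (use a in \<open>auto simp: n_def blinfun.zero_right\<close>)
qed

lemma norm_diff_scaleR_squared:
  "(norm (x - t *\<^sub>R y))\<^sup>2 = (norm x)\<^sup>2 - 2 * t * inner y x + t\<^sup>2 * (norm y)\<^sup>2"
  for x :: "'a::real_inner"
proof -
  have "(norm (t *\<^sub>R y))\<^sup>2 = t\<^sup>2 * (norm y)\<^sup>2" "inner x (t *\<^sub>R y) = t * inner y x"
    by (simp_all add: power_mult_distrib inner_commute)
  then show ?thesis
    using dot_norm_neg[of x "t *\<^sub>R y"] by argo
qed

lemma bounded_invertibleI:
  fixes A :: "'a::{complex_inner, complete_space} \<Rightarrow>\<^sub>L 'a"
  assumes lin: "clinear_op A" and c: "0 < c"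
    and A: "\<And>x. c * norm x \<le> norm (blinfun_apply A x)"
    and A': "\<And>x. c * norm x \<le> norm (blinfun_apply (cadjoint A) x)"
  shows "bounded_invertible A"
proof -
  \<comment> \<open>Solve \<open>A (A\<^sup>* x) = y\<close> by the contraction \<open>x - t (A (A\<^sup>* x) - y)\<close> with \<open>t\<close> small.\<close>
  have surj: "\<exists>x. A x = y" for y
  proof -
    \<comment> \<open>With \<open>t\<close> times the squared norm of \<open>A\<close> at most 1,
      the quadratic term of the expanded square uses up only half of the gain from the linear
      term.\<close>
    define t where "t = 1 / ((norm A)\<^sup>2 + 1)"
    have pos: "0 < (norm A)\<^sup>2 + 1"
      by (simp add: add_nonneg_pos)
    have t: "0 < t" "t * (norm A)\<^sup>2 \<le> 1"
      using pos by (auto simp: t_def)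
    define S where "S x = x - t *\<^sub>R (A (cadjoint A x) - y)" for x
    \<comment> \<open>The maximum with 0 matters on the zero space only, where \<open>c\<close> may
      be arbitrarily large.\<close>
    define k where "k = sqrt (max 0 (1 - t * c\<^sup>2))"
    have k: "0 \<le> k" "k < 1"
      using t c by (auto simp: k_def)
    have "dist (S u) (S v) \<le> k * dist u v" for u v
    proof (rule power2_le_imp_le)
      define x where "x = u - v"
      have "S u - S v = x - t *\<^sub>R A (cadjoint A x)"
        by (simp add: S_def x_def blinfun.diff_right algebra_simps)
      then have "(dist (S u) (S v))\<^sup>2 = (norm (x - t *\<^sub>R A (cadjoint A x)))\<^sup>2"
        by (simp add: dist_norm)
      also have "\<dots> = (norm x)\<^sup>2 - 2 * t * inner (A (cadjoint A x)) x + t\<^sup>2 * (norm (A (cadjoint A x)))\<^sup>2"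
        by (rule norm_diff_scaleR_squared)
      also have "inner (A (cadjoint A x)) x = (norm (cadjoint A x))\<^sup>2"
        by (simp add: inner_eq_Re_cinner cadjoint_cinner[OF lin] cinner_self)
      also have "t\<^sup>2 * (norm (A (cadjoint A x)))\<^sup>2 \<le> t\<^sup>2 * (norm A * norm (cadjoint A x))\<^sup>2"
        by (intro mult_left_mono power_mono norm_blinfun) auto
      also have "\<dots> = (t * (norm A)\<^sup>2) * (t * (norm (cadjoint A x))\<^sup>2)"
        by (simp add: power2_eq_square)
      also have "\<dots> \<le> 1 * (t * (norm (cadjoint A x))\<^sup>2)"
        using t by (intro mult_right_mono) auto
      finally have "(dist (S u) (S v))\<^sup>2 \<le> (norm x)\<^sup>2 - t * (norm (cadjoint A x))\<^sup>2"
        by simp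
      also have "\<dots> \<le> (norm x)\<^sup>2 - t * (c * norm x)\<^sup>2"
        using t A'[of x] c by (intro diff_mono mult_left_mono power_mono) auto
      also have "\<dots> = (1 - t * c\<^sup>2) * (norm x)\<^sup>2"
        by (simp add: power_mult_distrib algebra_simps)
      also have "\<dots> \<le> k\<^sup>2 * (norm x)\<^sup>2"
        by (intro mult_right_mono) (auto simp: k_def)
      finally show "(dist (S u) (S v))\<^sup>2 \<le> (k * dist u v)\<^sup>2"
        by (simp add: x_def dist_norm power_mult_distrib)
    qed (simp add: k)
    then obtain x where "S x = x"
      using banach_fix_type[OF k, of S] by blast
    then show ?thesis
      using t by (auto simp: S_def)
  qed
  have inj: "x = y" if "A x = A y" for x y
    using A[of "x - y"] c that by (auto simp: blinfun.diff_right mult_le_0_iff)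
  obtain G where AG: "\<And>y. A (G y) = y"
    using surj by metis
  have GA: "G (A x) = x" for x
    by (rule inj) (rule AG)
  have "bounded_linear G"
  proof (rule bounded_linear_intro[where K = "1 / c"])
    show "norm (G x) \<le> norm x * (1 / c)" for x
      using A[of "G x"] c by (simp add: AG field_simps)
  qed (rule inj, simp add: AG blinfun.add_right blinfun.scaleR_right)+
  then have G: "blinfun_apply (Blinfun G) = G"
    by (rule bounded_linear_Blinfun_apply)
  have "is_op_inverse A (Blinfun G)"
    unfolding is_op_inverse_def clinear_op_def
  proof (intro conjI allI)
    show "Blinfun G (c *\<^sub>C x) = c *\<^sub>C Blinfun G x" for c x
      by (rule inj) (simp add: G AG clinear_opD[OF lin])
  qed (auto simp: G AG GA intro!: blinfun_eqI)
  then show ?thesis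
    by (auto simp: bounded_invertible_def)
qed

lemma is_op_inverse_op_inverse: "bounded_invertible A \<Longrightarrow> is_op_inverse A (op_inverse A)"
  by (auto simp: bounded_invertible_def op_inverse_eqI)

text \<open>\<open>W\<close> is compared with \<open>V\<close>, for which the product of norms is
  below 1. If \<open>v = h - K (W h)\<close> is small, then so is the imaginary part of the form of
  \<open>W\<close> at \<open>h\<close>. By \<open>le\<close> and polarization \<open>W h\<close> is
  then close to \<open>V h\<close>, which makes \<open>h\<close> small.\<close>

lemma bounded_below_id_minus_compose:
  fixes K V W :: "'a::complex_inner \<Rightarrow>\<^sub>L 'a"
  assumes W: "clinear_op W" and V: "clinear_op V"
    and K: "\<And>x y. cinner (blinfun_apply K x) y = cinner x (blinfun_apply K y)" "norm K \<le> 1"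
    and KV: "norm K * norm V < 1"
    and le: "\<And>h. cmod (cinner (blinfun_apply (W - V) h) h) \<le> a * Im (cinner (blinfun_apply W h) h)"
  shows "\<exists>e>0. \<forall>h. e * norm h \<le> norm (blinfun_apply (id_blinfun - (K o\<^sub>L W)) h)"
proof -
  define T where "T = W - V"
  define c where "c = 1 - norm K * norm V"
  \<comment> \<open>Chosen so that \<open>p g / \<tau>\<close> is at most half the squared norm of
    \<open>g\<close>, which can be absorbed. The summand 1 keeps it positive.\<close>
  define \<tau> where "\<tau> = 2 * (\<bar>a\<bar> * norm W + 1)"
  define R where "R = 2 * \<tau> * (\<bar>a\<bar> * norm W)"
  define p where "p h = a * Im (cinner (W h) h)" for h
  have pos: "0 < c" "0 < \<tau>" "0 \<le> R"
    using KV by (auto simp: c_def \<tau>_def R_def add_nonneg_pos)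
  have p_le: "a * Im (cinner (W h) g) \<le> \<bar>a\<bar> * norm W * norm h * norm g" for h g
  proof -
    have "a * Im (cinner (W h) g) \<le> \<bar>a\<bar> * \<bar>Im (cinner (W h) g)\<bar>"
      by (metis abs_ge_self abs_mult)
    also have "\<dots> \<le> \<bar>a\<bar> * (norm W * norm h * norm g)"
      using abs_Im_le_cmod[of "cinner (W h) g"] norm_cinner_le[of "W h" g]
        mult_right_mono[OF norm_blinfun[of W h] norm_ge_zero[of g]]
      by (intro mult_left_mono) linarith+
    finally show ?thesis
      by (simp add: mult_ac)
  qed
  have T_le: "(norm (T h))\<^sup>2 \<le> 2 * \<tau> * p h" for h
  proof -
    define g where "g = T h"
    \<comment> \<open>Opposite scalings leave the inner product unchanged but shift weight between
      the two terms of the polarized bound.\<close>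
    have "(norm g)\<^sup>2 = cmod (cinner (T (sqrt \<tau> *\<^sub>R h)) ((1 / sqrt \<tau>) *\<^sub>R g))"
      using pos by (simp add: g_def blinfun.scaleR_right cinner_simps cinner_self norm_mult norm_divide norm_power)
    also have "\<dots> \<le> p (sqrt \<tau> *\<^sub>R h) + p ((1 / sqrt \<tau>) *\<^sub>R g)"
      unfolding p_def distrib_left[symmetric]
      by (rule norm_cinner_le_if_quadratic_form_le)
        (use le W V in \<open>auto simp: T_def intro: clinear_op_diff\<close>)
    also have "\<dots> = \<tau> * p h + p g / \<tau>"
      using pos by (simp add: p_def blinfun.scaleR_right cinner_simps)
    also have "p g \<le> \<tau> / 2 * (norm g)\<^sup>2"
    proof -
      have "p g \<le> \<bar>a\<bar> * norm W * (norm g)\<^sup>2"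
        using p_le[of g g] by (simp add: p_def power2_eq_square mult_ac)
      also have "\<dots> \<le> \<tau> / 2 * (norm g)\<^sup>2"
        by (intro mult_right_mono) (auto simp: \<tau>_def)
      finally show ?thesis .
    qed
    finally show ?thesis
      using pos by (simp add: g_def divide_right_mono)
  qed
  define e where "e = c / 2 / (1 + R / (2 * c))"
  have den: "0 < 1 + R / (2 * c)"
    using pos by (simp add: add_pos_nonneg)
  have "e * norm h \<le> norm ((id_blinfun - (K o\<^sub>L W)) h)" for h
  proof -
    define v where "v = h - K (W h)"
    \<comment> \<open>Symmetry of \<open>K\<close> makes this number real, so replacing
      \<open>h\<close> by \<open>v\<close> in the second argument does not change the imaginary
      part.\<close>
    have "cinner (W h) (K (W h)) = cnj (cinner (W h) (K (W h)))"
      using cinner_commute[of "W h" "K (W h)"] by (simp only: K(1))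
    then have "Im (cinner (W h) (K (W h))) = 0"
      by (simp add: complex_eq_iff)
    moreover have "cinner (W h) h = cinner (W h) v + cinner (W h) (K (W h))"
      by (simp add: v_def cinner_simps)
    ultimately have "p h \<le> \<bar>a\<bar> * norm W * norm h * norm v"
      using p_le[of h v] by (simp add: p_def)
    then have "2 * \<tau> * p h \<le> 2 * \<tau> * (\<bar>a\<bar> * norm W * norm h * norm v)"
      using pos by (intro mult_left_mono) auto
    then have "(norm (T h))\<^sup>2 \<le> R * (norm h * norm v)"
      using T_le[of h] by (simp add: R_def mult_ac)
    \<comment> \<open>The product is split for the inequality between arithmetic and geometric mean
      so that \<open>norm h\<close> receives the coefficient \<open>c / 2\<close>, half of what the
      final estimate can absorb.\<close>
    also have "\<dots> = 4 * (c / 2 * norm h) * (R / (2 * c) * norm v)"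
      using pos by (simp add: field_simps)
    also have "\<dots> \<le> (c / 2 * norm h + R / (2 * c) * norm v)\<^sup>2"
      using sum_squares_bound[of "c / 2 * norm h" "R / (2 * c) * norm v"]
      by (simp only: power2_sum)
    finally have Th: "norm (T h) \<le> c / 2 * norm h + R / (2 * c) * norm v"
      by (rule power2_le_imp_le) (use pos in auto)
    have "norm (K (V h)) \<le> norm K * norm V * norm h"
      using norm_blinfun[of K "V h"] mult_left_mono[OF norm_blinfun[of V h] norm_ge_zero[of K]]
      by (simp add: mult.assoc)
    moreover have "norm (K (T h)) \<le> norm (T h)"
      using norm_blinfun[of K "T h"] mult_right_mono[OF K(2) norm_ge_zero[of "T h"]] by simp
    moreover have "h = v + K (T h) + K (V h)"
      by (simp add: v_def T_def blinfun.diff_left blinfun.diff_right)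
    then have "norm h \<le> norm v + norm (K (T h)) + norm (K (V h))"
      using norm_triangle_ineq[of "v + K (T h)" "K (V h)"] norm_triangle_ineq[of v "K (T h)"] by simp
    ultimately have "c * norm h \<le> norm v + norm (T h)"
      by (simp add: c_def algebra_simps)
    then have "c / 2 * norm h \<le> (1 + R / (2 * c)) * norm v"
      using Th by (simp add: algebra_simps)
    then have "e * norm h \<le> norm v"
      using den by (simp add: e_def field_simps)
    then show ?thesis
      by (simp add: v_def blinfun.diff_left)
  qed
  moreover have "0 < e"
    using pos den by (simp add: e_def)
  ultimately show ?thesis
    by blast
qed

section \<open>Scalar Nevanlinna functions on the cut plane\<close>

lemma open_cut_plane: "open cut_plane"
proof -
  have "complex_of_real ` ({..-1} \<union> {1..}) = (\<real> \<inter> {z. Re z \<le> -1}) \<union> (\<real> \<inter> {z. 1 \<le> Re z})"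
    by (force simp: complex_is_Real_iff complex_eq_iff image_iff)
  then have "closed (complex_of_real ` ({..-1} \<union> {1..}))"
    by (simp add: closed_Un closed_Int closed_complex_Reals closed_halfspace_Re_le closed_halfspace_Re_ge)
  then show ?thesis
    by (simp add: cut_plane_def open_Compl)
qed

lemma cut_plane_iff: "z \<in> cut_plane \<longleftrightarrow> z \<notin> \<real> \<or> \<bar>Re z\<bar> < 1"
proof -
  have "z \<in> complex_of_real ` ({..-1} \<union> {1..}) \<longleftrightarrow> z \<in> \<real> \<and> 1 \<le> \<bar>Re z\<bar>"
    by (auto simp: complex_is_Real_iff complex_eq_iff image_iff intro: bexI[of _ "Re z"])
  then show ?thesis
    by (auto simp: cut_plane_def)
qed

lemma cnj_in_cut_plane_iff: "cnj z \<in> cut_plane \<longleftrightarrow> z \<in> cut_plane"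
  by (simp add: cut_plane_iff complex_is_Real_iff)

lemma of_real_in_cut_plane_iff: "complex_of_real x \<in> cut_plane \<longleftrightarrow> x \<in> {-1<..<1}"
  by (auto simp: cut_plane_iff)

lemma off_real_axis_subset_cut_plane: "- \<real> \<subseteq> cut_plane"
  by (auto simp: cut_plane_iff)

text \<open>The model is \<open>cinner (F z h) h\<close> for \<open>F\<close> in \<open>RS\<close>
  and arbitrary \<open>h\<close>. A bound by 1 on the interval would require \<open>h\<close> of
  norm at most 1, so the lemmas that use it assume it separately.\<close>

locale scalar_nevanlinna =
  fixes f :: "complex \<Rightarrow> complex"
  assumes hol: "f holomorphic_on cut_plane"
    and sym: "z \<notin> \<real> \<Longrightarrow> f (cnj z) = cnj (f z)"
    and pos: "z \<notin> \<real> \<Longrightarrow> 0 \<le> Im z * Im (f z)"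
    and real: "x \<in> {-1<..<1} \<Longrightarrow> f (of_real x) \<in> \<real>"
begin

lemma hol_off_real: "f holomorphic_on - \<real>"
  using hol off_real_axis_subset_cut_plane by (rule holomorphic_on_subset)

lemma DERIV_deriv: "x \<in> {-1<..<1} \<Longrightarrow> (f has_field_derivative deriv f (of_real x)) (at (of_real x))"
  using hol open_cut_plane by (rule holomorphic_derivI) (simp add: of_real_in_cut_plane_iff)

lemma DERIV_Re:
  assumes "x \<in> {-1<..<1}"
  shows "((\<lambda>x. Re (f (of_real x))) has_real_derivative Re (deriv f (of_real x))) (at x)"
proof -
  have "((\<lambda>x. f (of_real x)) has_vector_derivative 1 * deriv f (of_real x)) (at x)"
    using DERIV_deriv[OF assms] by (intro field_vector_diff_chain_at[unfolded o_def]) (auto intro!: derivative_eq_intros)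
  then have "((\<lambda>x. Re (f (of_real x))) has_vector_derivative Re (1 * deriv f (of_real x))) (at x)"
    by (rule bounded_linear.has_vector_derivative[OF bounded_linear_Re])
  then show ?thesis
    by (simp add: has_real_derivative_iff_has_vector_derivative)
qed

text \<open>This is the difference quotient in the direction \<open>\<i>\<close>: since
  \<open>f\<close> is real at \<open>x\<close>, its real part is
  \<open>Im (f (Complex x e)) / e\<close>.\<close>

lemma tendsto_Im_div:
  assumes x: "x \<in> {-1<..<1}"
  shows "((\<lambda>e. Im (f (Complex x e)) / e) \<longlongrightarrow> Re (deriv f (of_real x))) (at_right 0)"
proof -
  have "((\<lambda>h. (f (of_real x + h) - f (of_real x)) / h) \<longlongrightarrow> deriv f (of_real x)) (at 0)"
    using DERIV_deriv[OF x] by (simp add: DERIV_def)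
  moreover have "filterlim (\<lambda>e. \<i> * of_real e) (at (0::complex)) (at_right 0)"
  proof (rule filterlim_atI)
    show "((\<lambda>e. \<i> * of_real e) \<longlongrightarrow> (0::complex)) (at_right 0)"
      using tendsto_mult[OF tendsto_const tendsto_of_real[OF tendsto_ident_at], of \<i> 0 "{0<..}"]
      by simp
    show "\<forall>\<^sub>F e in at_right 0. \<i> * of_real e \<noteq> (0::complex)"
      using eventually_at_right_less[of "0::real"] by eventually_elim simp
  qed
  ultimately have "((\<lambda>e. (f (of_real x + \<i> * of_real e) - f (of_real x)) / (\<i> * of_real e))
      \<longlongrightarrow> deriv f (of_real x)) (at_right 0)"
    by (rule filterlim_compose)
  then have "((\<lambda>e. Re ((f (of_real x + \<i> * of_real e) - f (of_real x)) / (\<i> * of_real e)))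
      \<longlongrightarrow> Re (deriv f (of_real x))) (at_right 0)"
    by (rule tendsto_Re)
  moreover have "Re ((f (of_real x + \<i> * of_real e) - f (of_real x)) / (\<i> * of_real e))
      = Im (f (Complex x e)) / e" for e
  proof -
    have "Re (w / (\<i> * of_real e)) = Im w / e" for w
      by (simp add: Re_divide power2_eq_square)
    moreover have "Im (f (of_real x)) = 0"
      using real[OF x] by (simp add: complex_is_Real_iff)
    ultimately show ?thesis
      by (simp add: Complex_eq mult.commute)
  qed
  ultimately show ?thesis
    by simp
qed

lemma Re_deriv_nonneg:
  assumes x: "x \<in> {-1<..<1}"
  shows "0 \<le> Re (deriv f (of_real x))"
proof (rule tendsto_lowerbound[OF tendsto_Im_div[OF x]])
  show "\<forall>\<^sub>F e in at_right 0. 0 \<le> Im (f (Complex x e)) / e"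
    using eventually_at_right_less[of "0::real"]
  proof eventually_elim
    case (elim e)
    then show ?case
      using pos[of "Complex x e"] by (simp add: complex_is_Real_iff zero_le_mult_iff)
  qed
qed simp

text \<open>Apply Schwarz-Pick at height \<open>e\<close> above \<open>s\<close> and
  \<open>t\<close>, divide by the square of \<open>e\<close> and let \<open>e\<close> tend to 0. The
  imaginary parts over \<open>e\<close> become derivatives.\<close>

lemma boundary_Schwarz_Pick:
  assumes s: "s \<in> {-1<..<1}" and t: "t \<in> {-1<..<1}"
  shows "(cmod (f (of_real s) - f (of_real t)))\<^sup>2
    \<le> (s - t)\<^sup>2 * (Re (deriv f (of_real s)) * Re (deriv f (of_real t)))"
proof -
  have lim: "((\<lambda>e. f (Complex x e)) \<longlongrightarrow> f (of_real x)) (at_right 0)" if "x \<in> {-1<..<1}" for x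
  proof -
    have "((\<lambda>e. Complex x e) \<longlongrightarrow> Complex x 0) (at_right 0)"
      by (rule tendsto_Complex[OF tendsto_const tendsto_ident_at])
    then show ?thesis
      by (intro isCont_tendsto_compose[OF DERIV_isCont[OF DERIV_deriv[OF that]]])
        (simp add: Complex_eq)
  qed
  have real_t: "cnj (f (of_real t)) = f (of_real t)"
    using real[OF t] by (simp add: Reals_cnj_iff)
  have "(cmod (f (Complex s e) - cnj (f (Complex t e))))\<^sup>2
      \<le> (cmod (Complex s e - cnj (Complex t e)))\<^sup>2 * (Im (f (Complex s e)) / e * (Im (f (Complex t e)) / e))"
    if "0 < e" for e
    using Schwarz_Pick_off_real_axis[OF hol_off_real sym pos, of "Complex s e" "Complex t e"] that
    by (simp add: field_simps)
  moreover have "((\<lambda>e. (cmod (f (Complex s e) - cnj (f (Complex t e))))\<^sup>2)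
      \<longlongrightarrow> (cmod (f (of_real s) - cnj (f (of_real t))))\<^sup>2) (at_right 0)"
    by (intro tendsto_power tendsto_norm tendsto_diff tendsto_cnj lim s t)
  moreover have "((\<lambda>e. (cmod (Complex s e - cnj (Complex t e)))\<^sup>2
      * (Im (f (Complex s e)) / e * (Im (f (Complex t e)) / e)))
      \<longlongrightarrow> (cmod (Complex s 0 - cnj (Complex t 0)))\<^sup>2
        * (Re (deriv f (of_real s)) * Re (deriv f (of_real t)))) (at_right 0)"
    by (intro tendsto_mult tendsto_power tendsto_norm tendsto_diff tendsto_cnj tendsto_Complex
        tendsto_const tendsto_ident_at tendsto_Im_div s t)
  ultimately have "(cmod (f (of_real s) - cnj (f (of_real t))))\<^sup>2
      \<le> (cmod (Complex s 0 - cnj (Complex t 0)))\<^sup>2 * (Re (deriv f (of_real s)) * Re (deriv f (of_real t)))"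
    by (intro tendsto_le[of "at_right (0::real)"]) (auto simp: eventually_at_right_field intro: exI[of _ 1])
  then show ?thesis
    by (simp add: real_t cmod_power2)
qed

text \<open>
  If \<open>f x\<close> is close to \<open>1\<close>, then \<open>f'\<close> is small somewhere between \<open>x\<close> and \<open>1\<close>; the boundary
  Schwarz--Pick inequality between that point and \<open>0\<close> then makes \<open>f x\<close> small.
\<close>

lemma Re_le_if_zero:
  assumes zero: "f 0 = 0" and le: "\<And>x. x \<in> {-1<..<1} \<Longrightarrow> Re (f (of_real x)) \<le> 1"
    and M: "Re (deriv f 0) \<le> M" "1 \<le> M" and x: "0 \<le> x" "x < 1"
  shows "Re (f (of_real x)) \<le> 1 - (1 - x) / (8 * M)" "0 \<le> Re (f (of_real x))"
proof -
  define g where "g x = Re (f (of_real x))" for x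
  define d where "d = (1 - x) / 2"
  have d: "0 < d" "d \<le> 1" "x + d < 1"
    using x by (auto simp: d_def field_simps)
  have mono: "g s \<le> g t" if "-1 < s" "s \<le> t" "t < 1" for s t
  proof (rule DERIV_nonneg_imp_nondecreasing[OF that(2)])
    fix y
    assume "s \<le> y" "y \<le> t"
    then have "y \<in> {-1<..<1}"
      using that by auto
    from DERIV_Re[OF this] Re_deriv_nonneg[OF this]
    show "\<exists>D. (g has_real_derivative D) (at y) \<and> 0 \<le> D"
      unfolding g_def by blast
  qed
  have g0: "0 \<le> g x"
    using mono[of 0 x] x zero by (simp add: g_def)
  then show "0 \<le> Re (f (of_real x))"
    by (simp add: g_def)
  have "\<exists>s. x < s \<and> s < x + d \<and> g (x + d) - g x = (x + d - x) * Re (deriv f (of_real s))"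
    unfolding g_def using x d by (intro MVT2 DERIV_Re) auto
  then obtain s where s: "x < s" "s < x + d" "g (x + d) - g x = d * Re (deriv f (of_real s))"
    by auto
  define b where "b = Re (deriv f (of_real s))"
  have s1: "s \<in> {-1<..<1}"
    using s x d by auto
  have b: "0 \<le> b"
    unfolding b_def by (rule Re_deriv_nonneg[OF s1])
  have "(g x)\<^sup>2 \<le> (g s)\<^sup>2"
    using g0 mono[of x s] x s d by (intro power_mono) auto
  also have "\<dots> \<le> (cmod (f (of_real s) - f (of_real 0)))\<^sup>2"
    by (simp add: zero g_def cmod_power2)
  also have "\<dots> \<le> (s - 0)\<^sup>2 * (b * Re (deriv f (of_real 0)))"
    unfolding b_def by (intro boundary_Schwarz_Pick s1) auto
  also have "\<dots> \<le> 1 * (b * M)"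
    using b M s1 s x d Re_deriv_nonneg[of 0] by (intro mult_mono mult_left_mono) (auto simp: abs_square_le_1)
  finally have "(g x)\<^sup>2 * d \<le> (b * M) * d"
    using d by (intro mult_right_mono) auto
  also have "\<dots> = M * (g (x + d) - g x)"
    using s by (simp add: b_def)
  also have "\<dots> \<le> M * (1 - g x)"
    using le[of "x + d"] M x d by (intro mult_left_mono) (auto simp: g_def)
  finally have main: "(g x)\<^sup>2 * d \<le> M * (1 - g x)" .
  \<comment> \<open>If \<open>g x\<close> is at most 1/2, this follows from \<open>1 \<le> M\<close>
    and \<open>d \<le> 1\<close>. Otherwise the square of \<open>g x\<close> is at least 1/4, whence
    the factor 4. As \<open>d\<close> is half of \<open>1 - x\<close>, the final constant is
    8.\<close>
  have "d \<le> 4 * M * (1 - g x)"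
  proof (cases "g x \<le> 1 / 2")
    case True
    then have "1 * (1 / 2) \<le> M * (1 - g x)"
      using M by (intro mult_mono) auto
    then show ?thesis
      using d by simp
  next
    case False
    then have "(1 / 2)\<^sup>2 * d \<le> (g x)\<^sup>2 * d"
      using d by (intro mult_right_mono power_mono) auto
    then show ?thesis
      using main by (simp add: power2_eq_square)
  qed
  then show "Re (f (of_real x)) \<le> 1 - (1 - x) / (8 * M)"
    using M by (simp add: g_def d_def field_simps)
qed

text \<open>This transfers the estimate for nonnegative arguments to negative ones. The derivative
  at 0 is unchanged, so the same \<open>M\<close> serves.\<close>

lemma reflect: "scalar_nevanlinna (\<lambda>z. - f (- z))"
proof
  have "(f \<circ> uminus) holomorphic_on cut_plane"
    by (rule holomorphic_on_compose_gen[OF _ hol])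
      (auto intro!: holomorphic_intros simp: cut_plane_iff complex_is_Real_iff)
  then show "(\<lambda>z. - f (- z)) holomorphic_on cut_plane"
    by (auto simp: o_def intro: holomorphic_intros)
  show "- f (- cnj z) = cnj (- f (- z))" if "z \<notin> \<real>" for z
    using sym[of "- z"] that by simp
  show "0 \<le> Im z * Im (- f (- z))" if "z \<notin> \<real>" for z
    using pos[of "- z"] that by simp
  show "- f (- of_real x) \<in> \<real>" if "x \<in> {-1<..<1}" for x
    using real[of "- x"] that by simp
qed

text \<open>The bound depends on \<open>f\<close> only through \<open>M\<close>, which makes it
  uniform over the forms of all unit vectors.\<close>

lemma norm_le_if_zero:
  assumes zero: "f 0 = 0" and le: "\<And>x. x \<in> {-1<..<1} \<Longrightarrow> cmod (f (of_real x)) \<le> 1"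
    and M: "Re (deriv f 0) \<le> M" "1 \<le> M" and x: "x \<in> {-1<..<1}"
  shows "cmod (f (of_real x)) \<le> 1 - (1 - \<bar>x\<bar>) / (8 * M)"
proof -
  have norm: "cmod (f (of_real x)) = \<bar>Re (f (of_real x))\<bar>"
    using real[OF x] by (auto simp: Reals_def)
  have le': "\<bar>Re (f (of_real x))\<bar> \<le> 1" if "x \<in> {-1<..<1}" for x
    using le[OF that] abs_Re_le_cmod order_trans by blast
  show ?thesis
  proof (cases "0 \<le> x")
    case True
    then show ?thesis
      unfolding norm using Re_le_if_zero[OF zero _ M, of x] le' x by (simp add: abs_le_iff)
  next
    case False
    interpret r: scalar_nevanlinna "\<lambda>z. - f (- z)"
      by (rule reflect)
    have "(f has_field_derivative deriv f 0) (at (- 0))"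
      using DERIV_deriv[of 0] by simp
    then have "((\<lambda>z. - f (- z)) has_field_derivative - (deriv f 0 * - 1)) (at 0)"
      by (intro DERIV_minus DERIV_chain2[where g = uminus] DERIV_ident)
    then have "deriv (\<lambda>z. - f (- z)) 0 = deriv f 0"
      using DERIV_imp_deriv by fastforce
    moreover have "Re (- f (- of_real y)) \<le> 1" if "y \<in> {-1<..<1}" for y
      using le'[of "- y"] that by simp
    ultimately show ?thesis
      unfolding norm using r.Re_le_if_zero[of M "- x"] False x M zero by simp
  qed
qed

end

section \<open>The class RS\<close>

lemma norm_scaleC_blinfun:
  "norm (c *\<^sub>C A) = cmod c * norm A" for A :: "'a::real_normed_vector \<Rightarrow>\<^sub>L 'b::complex_inner"
proof (cases "c = 0")
  case False
  have le: "norm (d *\<^sub>C B) \<le> cmod d * norm B" for d and B :: "'a \<Rightarrow>\<^sub>L 'b"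
  proof (rule norm_blinfun_bound)
    show "norm ((d *\<^sub>C B) x) \<le> cmod d * norm B * norm x" for x
      using mult_left_mono[OF norm_blinfun[of B x] norm_ge_zero[of d]]
      by (simp only: scaleC_blinfun.rep_eq norm_scaleC mult.assoc)
  qed simp
  have "A = (1 / c) *\<^sub>C (c *\<^sub>C A)"
    using False by (simp add: scaleC_scaleC scaleC_one)
  then have "norm A \<le> cmod (1 / c) * norm (c *\<^sub>C A)"
    using le[of "1 / c" "c *\<^sub>C A"] by simp
  then have "cmod c * norm A \<le> norm (c *\<^sub>C A)"
    using False by (simp add: norm_divide field_simps)
  then show ?thesis
    using le[of c A] by simp
qed (use scaleR_scaleC[of 0 A] in simp)

lemma has_derivative_scaleC_iff:
  fixes F :: "complex \<Rightarrow> 'a::real_normed_vector \<Rightarrow>\<^sub>L 'b::complex_inner"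
  shows "(F has_derivative (\<lambda>h. h *\<^sub>C D)) (at z)
    \<longleftrightarrow> ((\<lambda>w. (1 / (w - z)) *\<^sub>C (F w - F z)) \<longlongrightarrow> D) (at z)"
proof -
  have "bounded_linear (\<lambda>h. h *\<^sub>C D)"
    by (rule bounded_linear_intro[where K = "norm D"])
      (auto simp: scaleC_add_left scaleR_scaleC scaleC_scaleC scaleR_conv_of_real norm_scaleC_blinfun)
  then have "(F has_derivative (\<lambda>h. h *\<^sub>C D)) (at z)
    \<longleftrightarrow> ((\<lambda>w. norm ((F w - F z) - (w - z) *\<^sub>C D) / norm (w - z)) \<longlongrightarrow> 0) (at z)"
    by (simp add: has_derivative_iff_norm)
  also have "\<dots> \<longleftrightarrow> ((\<lambda>w. norm ((1 / (w - z)) *\<^sub>C (F w - F z) - D)) \<longlongrightarrow> 0) (at z)"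
  proof (rule tendsto_cong)
    have "norm ((F w - F z) - (w - z) *\<^sub>C D) / norm (w - z) = norm ((1 / (w - z)) *\<^sub>C (F w - F z) - D)"
      if "w \<noteq> z" for w
    proof -
      have "(w - z) *\<^sub>C ((1 / (w - z)) *\<^sub>C (F w - F z) - D) = (F w - F z) - (w - z) *\<^sub>C D"
        using that
        by (intro blinfun_eqI)
          (simp add: scaleC_blinfun.rep_eq blinfun.diff_left scaleC_diff_right scaleC_scaleC scaleC_one)
      from arg_cong[OF this, of norm] have "norm ((F w - F z) - (w - z) *\<^sub>C D)
          = cmod (w - z) * norm ((1 / (w - z)) *\<^sub>C (F w - F z) - D)"
        unfolding norm_scaleC_blinfun by (rule sym)
      then show ?thesis
        using that by simp
    qed
    then show "\<forall>\<^sub>F w in at z. norm ((F w - F z) - (w - z) *\<^sub>C D) / norm (w - z)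
        = norm ((1 / (w - z)) *\<^sub>C (F w - F z) - D)"
      unfolding eventually_at_filter by (intro always_eventually) blast
  qed
  also have "\<dots> \<longleftrightarrow> ((\<lambda>w. (1 / (w - z)) *\<^sub>C (F w - F z)) \<longlongrightarrow> D) (at z)"
    by (simp add: tendsto_norm_zero_iff Lim_null[of _ D])
  finally show ?thesis .
qed

lemma op_holomorphic_on_open_iff:
  assumes "open S"
  shows "op_holomorphic_on F S \<longleftrightarrow>
    (\<forall>z\<in>S. clinear_op (F z) \<and> (\<exists>D. ((\<lambda>w. (1 / (w - z)) *\<^sub>C (F w - F z)) \<longlongrightarrow> D) (at z)))"
  unfolding op_holomorphic_on_def
  using at_within_open[OF _ assms] by (auto simp: has_derivative_scaleC_iff)

lemma has_field_derivative_cinner: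
  assumes "(F has_derivative (\<lambda>h. h *\<^sub>C D)) (at z within S)"
  shows "((\<lambda>z. cinner (blinfun_apply (F z) x) y) has_field_derivative cinner (blinfun_apply D x) y)
    (at z within S)"
proof -
  have "bounded_linear (\<lambda>A. cinner (blinfun_apply A x) y)"
    using bounded_linear_cinner_left blinfun.bounded_linear_left by (rule bounded_linear_compose)
  from bounded_linear.has_derivative[OF this assms] show ?thesis
    by (simp add: has_field_derivative_def scaleC_blinfun.rep_eq cinner_simps mult_commute_abs)
qed

lemma op_holomorphic_on_cinner:
  "op_holomorphic_on F S \<Longrightarrow> (\<lambda>z. cinner (blinfun_apply (F z) x) y) holomorphic_on S"
  unfolding op_holomorphic_on_def holomorphic_on_def field_differentiable_def
  using has_field_derivative_cinner by blast

lemma cinner_op_Im: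
  fixes A :: "'a::{complex_inner, complete_space} \<Rightarrow>\<^sub>L 'a"
  assumes "clinear_op A"
  shows "cinner (blinfun_apply (op_Im A) h) h = of_real (Im (cinner (blinfun_apply A h) h))"
proof -
  have "cinner (cadjoint A h) h = cnj (cinner (A h) h)"
    by (metis cadjoint_cinner_left[OF assms] cinner_commute)
  then show ?thesis
    by (simp add: op_Im_def scaleC_blinfun.rep_eq blinfun.diff_left cinner_simps complex_eq_iff
        Re_divide Im_divide)
qed

text \<open>Symmetry on the whole cut plane contains both the adjoint condition off the axis and the
  reality of the forms on the interval. There the norm bound yields the two order bounds.\<close>

lemma RS_I:
  fixes F :: "complex \<Rightarrow> 'a::{complex_inner, complete_space} \<Rightarrow>\<^sub>L 'a"
  assumes hol: "op_holomorphic_on F cut_plane"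
    and sym: "\<And>z x y. z \<in> cut_plane \<Longrightarrow> cinner (blinfun_apply (F z) x) y = cinner x (blinfun_apply (F (cnj z)) y)"
    and Im: "\<And>z h. z \<notin> \<real> \<Longrightarrow> 0 \<le> Im z * Im (cinner (blinfun_apply (F z) h) h)"
    and le: "\<And>x. x \<in> {-1<..<1} \<Longrightarrow> norm (F (of_real x)) \<le> 1"
  shows "F \<in> RS"
proof -
  have lin: "clinear_op (F z)" if "z \<in> - \<real>" for z
    using hol that off_real_axis_subset_cut_plane by (auto simp: op_holomorphic_on_def)
  have "op_holomorphic_on F (- \<real>)"
    unfolding op_holomorphic_on_def
  proof (intro conjI ballI)
    fix z :: complex
    assume z: "z \<in> - \<real>"
    then obtain D where "(F has_derivative (\<lambda>h. h *\<^sub>C D)) (at z within cut_plane)"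
      using hol off_real_axis_subset_cut_plane unfolding op_holomorphic_on_def by blast
    from has_derivative_subset[OF this off_real_axis_subset_cut_plane]
    show "\<exists>D. (F has_derivative (\<lambda>h. h *\<^sub>C D)) (at z within - \<real>)"
      by blast
  qed (rule lin)
  moreover have "cadjoint (F z) = F (cnj z)" if "z \<in> - \<real>" for z
    using that off_real_axis_subset_cut_plane by (intro cadjoint_eqI sym) auto
  moreover have "nonneg_op (Im z *\<^sub>R op_Im (F z))" if "z \<in> - \<real>" for z
  proof -
    have "cinner ((Im z *\<^sub>R op_Im (F z)) h) h = of_real (Im z * Im (cinner (F z h) h))" for h
      by (simp add: blinfun.scaleR_left cinner_scaleR_left cinner_op_Im[OF lin[OF that]])
    then show ?thesis
      using Im[of z] that unfolding nonneg_op_def by simp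
  qed
  moreover have "op_le (- id_blinfun) (F (of_real x)) \<and> op_le (F (of_real x)) id_blinfun"
    if "x \<in> {-1<..<1}" for x
  proof -
    have "cinner (F (of_real x) h) h \<in> \<real>" for h
    proof -
      have "cinner (F (of_real x) h) h = cinner h (F (of_real x) h)"
        using sym[of "of_real x" h h] that by (simp add: of_real_in_cut_plane_iff)
      also have "\<dots> = cnj (cinner (F (of_real x) h) h)"
        by (rule cinner_commute)
      finally show ?thesis
        by (metis Reals_cnj_iff)
    qed
    moreover have "\<bar>Re (cinner (F (of_real x) h) h)\<bar> \<le> (norm h)\<^sup>2" for h
    proof -
      have "\<bar>Re (cinner (F (of_real x) h) h)\<bar> \<le> norm (F (of_real x) h) * norm h"
        by (rule order_trans[OF abs_Re_le_cmod norm_cinner_le])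
      also have "\<dots> \<le> (1 * norm h) * norm h"
        by (intro mult_right_mono order_trans[OF norm_blinfun] le that norm_ge_zero)
      finally show ?thesis
        by (simp add: power2_eq_square)
    qed
    moreover have "cinner ((F (of_real x) - (- id_blinfun)) h) h
          = cinner (F (of_real x) h) h + of_real ((norm h)\<^sup>2)"
        "cinner ((id_blinfun - F (of_real x)) h) h = of_real ((norm h)\<^sup>2) - cinner (F (of_real x) h) h" for h
      by (simp_all add: blinfun.diff_left blinfun.add_left cinner_add_left cinner_diff_left cinner_self)
    ultimately show ?thesis
      unfolding op_le_def nonneg_op_def by (simp add: abs_le_iff add.commute le_diff_eq) (smt (verit))
  qed
  ultimately show ?thesis
    using hol by (simp add: RS_def nevanlinna_def)
qed

section \<open>Consequences of membership in RS\<close>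

context
  fixes F :: "complex \<Rightarrow> 'a::{complex_inner, complete_space} \<Rightarrow>\<^sub>L 'a"
  assumes F: "F \<in> RS"
begin

lemma RS_op_holomorphic: "op_holomorphic_on F cut_plane"
  using F by (simp add: RS_def)

lemma RS_clinear: "z \<in> cut_plane \<Longrightarrow> clinear_op (F z)"
  using RS_op_holomorphic by (simp add: op_holomorphic_on_def)

lemma RS_quadratic_form:
  assumes x: "x \<in> {-1<..<1}"
  shows "cinner (blinfun_apply (F (of_real x)) h) h \<in> \<real>"
    and "cmod (cinner (blinfun_apply (F (of_real x)) h) h) \<le> (norm h)\<^sup>2"
proof -
  have le: "nonneg_op (F (of_real x) - (- id_blinfun))" "nonneg_op (id_blinfun - F (of_real x))"
    using F x by (auto simp: RS_def op_le_def)
  have real: "of_real ((norm h)\<^sup>2) - cinner (F (of_real x) h) h \<in> \<real>"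
    and up: "Re (cinner (F (of_real x) h) h) \<le> (norm h)\<^sup>2"
    using le(2)[unfolded nonneg_op_def, rule_format, of h]
    by (simp_all add: blinfun.diff_left cinner_simps cinner_self)
  have low: "- (norm h)\<^sup>2 \<le> Re (cinner (F (of_real x) h) h)"
    using le(1)[unfolded nonneg_op_def, rule_format, of h]
    by (simp add: blinfun.add_left cinner_simps cinner_self)
  show r: "cinner (F (of_real x) h) h \<in> \<real>"
    using real by (simp add: complex_is_Real_iff)
  then show "cmod (cinner (F (of_real x) h) h) \<le> (norm h)\<^sup>2"
    using up low by (auto elim!: Reals_cases)
qed

text \<open>Off the axis this is the Nevanlinna symmetry. On the interval it comes from the order
  bounds, which force the quadratic form to be real.\<close>

lemma RS_cinner:
  assumes z: "z \<in> cut_plane"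
  shows "cinner (blinfun_apply (F z) x) y = cinner x (blinfun_apply (F (cnj z)) y)"
proof (cases "z \<in> \<real>")
  case True
  then obtain r where "z = of_real r" "r \<in> {-1<..<1}"
    using z by (auto elim!: Reals_cases simp: of_real_in_cut_plane_iff)
  then show ?thesis
    using cinner_eq_if_quadratic_form_real[OF RS_clinear[OF z]] RS_quadratic_form(1) by auto
next
  case False
  then show ?thesis
    using F cadjoint_cinner[OF RS_clinear[OF z]] by (simp add: RS_def nevanlinna_def)
qed

lemma RS_Im:
  assumes z: "z \<notin> \<real>"
  shows "0 \<le> Im z * Im (cinner (blinfun_apply (F z) h) h)"
proof -
  have "nonneg_op (Im z *\<^sub>R op_Im (F z))"
    using F z by (simp add: RS_def nevanlinna_def)
  moreover have "clinear_op (F z)"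
    using z by (simp add: RS_clinear cut_plane_iff)
  ultimately show ?thesis
    unfolding nonneg_op_def by (simp add: blinfun.scaleR_left cinner_simps cinner_op_Im)
qed

lemma RS_scalar_nevanlinna: "scalar_nevanlinna (\<lambda>z. cinner (blinfun_apply (F z) h) h)"
proof
  show "cinner (F (cnj z) h) h = cnj (cinner (F z h) h)" if "z \<notin> \<real>" for z
    using RS_cinner[of z h h] that
    by (subst cinner_commute) (simp add: cut_plane_iff)
qed (use RS_op_holomorphic in \<open>auto intro: op_holomorphic_on_cinner RS_Im RS_quadratic_form\<close>)

lemma RS_norm_le:
  assumes x: "x \<in> {-1<..<1}"
  shows "norm (F (of_real x)) \<le> 1"
  using RS_cinner[of "of_real x"] RS_quadratic_form(2)[OF x] x
  by (intro norm_le_if_quadratic_form_le) (simp_all add: of_real_in_cut_plane_iff)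

text \<open>A strict bound for each vector separately would not suffice, so one \<open>q < 1\<close>
  is found for all unit vectors. The norm of the operator derivative at 0 bounds the derivatives of
  all their scalar functions, giving a common \<open>M\<close>.\<close>

lemma RS_norm_less:
  assumes zero: "F 0 = 0" and x: "x \<in> {-1<..<1}"
  shows "norm (F (of_real x)) < 1"
proof -
  have z0: "0 \<in> cut_plane"
    by (simp add: cut_plane_iff)
  then obtain D where D: "(F has_derivative (\<lambda>h. h *\<^sub>C D)) (at 0)"
    using RS_op_holomorphic at_within_open[OF z0 open_cut_plane]
    by (auto simp: op_holomorphic_on_def)
  define M where "M = norm D + 1"
  define q where "q = 1 - (1 - \<bar>x\<bar>) / (8 * M)"
  have M: "1 \<le> M"
    by (simp add: M_def)
  have q: "0 \<le> q" "q < 1"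
    using M x by (auto simp: q_def field_simps)
  have unit: "cmod (cinner (F (of_real x) h) h) \<le> q" if h: "norm h = 1" for h
  proof -
    interpret scalar_nevanlinna "\<lambda>z. cinner (F z h) h"
      by (rule RS_scalar_nevanlinna)
    have "Re (deriv (\<lambda>z. cinner (F z h) h) 0) = Re (cinner (D h) h)"
      using DERIV_imp_deriv[OF has_field_derivative_cinner[OF D, of h h]] by simp
    also have "\<dots> \<le> norm (D h) * norm h"
      by (rule order_trans[OF complex_Re_le_cmod norm_cinner_le])
    also have "\<dots> \<le> M"
      using norm_blinfun[of D h] h by (simp add: M_def)
    finally show ?thesis
      unfolding q_def using M x RS_quadratic_form(2)[of _ h] h zero
      by (intro norm_le_if_zero) (auto simp: cinner_zero_left)
  qed
  have "cmod (cinner (F (of_real x) h) h) \<le> q * (norm h)\<^sup>2" for h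
  proof (cases "h = 0")
    case False
    have "cmod (cinner (F (of_real x) (sgn h)) (sgn h)) \<le> q"
      using False by (intro unit) (simp add: norm_sgn)
    then show ?thesis
      using False by (simp add: sgn_div_norm blinfun.scaleR_right cinner_simps norm_mult norm_divide
          power2_eq_square field_simps)
  qed (simp add: blinfun.zero_right cinner_zero_left)
  then have "norm (F (of_real x)) \<le> q"
    using RS_cinner[of "of_real x"] x q
    by (intro norm_le_if_quadratic_form_le) (simp_all add: of_real_in_cut_plane_iff)
  then show ?thesis
    using q by simp
qed

end

text \<open>The identity \<open>R w - R z = R w (A z - A w) R z\<close> reduces continuity to a
  bound on \<open>R w\<close> near \<open>z\<close>. That bound, \<open>2 * r\<close>, follows by
  absorbing the perturbation \<open>A w - A z\<close> once its norm is below
  \<open>1 / (2 * r)\<close>.\<close>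

lemma tendsto_op_inverse:
  fixes A :: "'b::metric_space \<Rightarrow> 'a::complex_inner \<Rightarrow>\<^sub>L 'a"
  assumes lim: "(A \<longlongrightarrow> A z) (at z)"
    and inv: "\<forall>\<^sub>F w in at z. bounded_invertible (A w)" and inv_z: "bounded_invertible (A z)"
  shows "((\<lambda>w. op_inverse (A w)) \<longlongrightarrow> op_inverse (A z)) (at z)"
proof -
  define R where "R w = op_inverse (A w)" for w
  define r where "r = norm (R z) + 1"
  have r: "0 < r"
    by (simp add: r_def add_nonneg_pos)
  have R: "R w (A w x) = x" "A w (R w x) = x" if "bounded_invertible (A w)" for w x
    using is_op_inverse_op_inverse[OF that] unfolding is_op_inverse_def R_def
    by (metis blinfun_apply_blinfun_compose blinfun_apply_id_blinfun)+
  have lim0: "((\<lambda>w. norm (A w - A z)) \<longlongrightarrow> 0) (at z)"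
    using lim by (simp add: tendsto_norm_zero_iff Lim_null[of A])
  have bound: "norm (R w - R z) \<le> 2 * r * r * norm (A w - A z)"
    if w: "bounded_invertible (A w)" and small: "norm (A w - A z) < 1 / (2 * r)" for w
  proof -
    have R_w: "norm (R w y) \<le> 2 * r * norm y" for y
    proof -
      define x where "x = R w y"
      have "norm x = norm (R z (A z x))"
        by (simp add: R(1)[OF inv_z])
      also have "\<dots> \<le> r * norm (A z x)"
        using norm_blinfun[of "R z" "A z x"] by (simp add: r_def distrib_right add_increasing2)
      also have "A z x = y - (A w - A z) x"
        by (simp add: x_def blinfun.diff_left R(2)[OF w])
      also have "norm (y - (A w - A z) x) \<le> norm y + norm (A w - A z) * norm x"
        using norm_triangle_ineq4[of y "(A w - A z) x"] norm_blinfun[of "A w - A z" x] by linarith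
      also have "\<dots> \<le> norm y + 1 / (2 * r) * norm x"
        using small by (intro add_left_mono mult_right_mono) auto
      finally have "norm x \<le> r * (norm y + 1 / (2 * r) * norm x)"
        using r by simp
      then show ?thesis
        using r by (simp add: x_def distrib_left)
    qed
    show ?thesis
    proof (rule norm_blinfun_bound)
      fix x
      have "(R w - R z) x = R w ((A z - A w) (R z x))"
        by (simp add: blinfun.diff_left blinfun.diff_right R(1)[OF w] R(2)[OF inv_z])
      then have "norm ((R w - R z) x) \<le> 2 * r * norm ((A z - A w) (R z x))"
        by (simp add: R_w)
      also have "\<dots> \<le> 2 * r * (norm (A z - A w) * (norm (R z) * norm x))"
        using r by (intro mult_left_mono order_trans[OF norm_blinfun] norm_blinfun) auto
      also have "\<dots> \<le> 2 * r * (norm (A z - A w) * (r * norm x))"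
        using r by (intro mult_left_mono mult_right_mono) (auto simp: r_def)
      finally show "norm ((R w - R z) x) \<le> 2 * r * r * norm (A w - A z) * norm x"
        by (simp add: norm_minus_commute mult_ac)
    qed (use r in simp)
  qed
  have "\<forall>\<^sub>F w in at z. norm (A w - A z) < 1 / (2 * r)"
    using lim0 r by (intro order_tendstoD) auto
  with inv have "\<forall>\<^sub>F w in at z. norm (R w - R z) \<le> 2 * r * r * norm (A w - A z)"
    by eventually_elim (rule bound)
  moreover have "((\<lambda>w. 2 * r * r * norm (A w - A z)) \<longlongrightarrow> 0) (at z)"
    using tendsto_mult_right_zero[OF lim0] .
  ultimately have "((\<lambda>w. R w - R z) \<longlongrightarrow> 0) (at z)"
    by (rule Lim_null_comparison)
  then show ?thesis
    unfolding R_def by (simp add: Lim_null[of "\<lambda>w. op_inverse (A w)"])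
qed

section \<open>Invertibility of \<open>id_blinfun - (K o\<^sub>L F z)\<close> on the cut
  plane\<close>

lemma RS_isCont:
  fixes F :: "complex \<Rightarrow> 'a::{complex_inner, complete_space} \<Rightarrow>\<^sub>L 'a"
  assumes F: "F \<in> RS" and z: "z \<in> cut_plane"
  shows "isCont F z"
proof -
  obtain D where "(F has_derivative (\<lambda>h. h *\<^sub>C D)) (at z within cut_plane)"
    using RS_op_holomorphic[OF F] z unfolding op_holomorphic_on_def by blast
  then show ?thesis
    using has_derivative_continuous at_within_open[OF z open_cut_plane] by metis
qed

text \<open>At real \<open>z\<close> the triangle inequality suffices. At other \<open>z\<close> the
  operator \<open>F z\<close> is compared with \<open>F w\<close> for \<open>w\<close> near 0 in the
  same half plane, where continuity preserves the strict bound known at 0.\<close>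

lemma RS_bounded_below:
  fixes K :: "'a::{complex_inner, complete_space} \<Rightarrow>\<^sub>L 'a"
  assumes F: "F \<in> RS"
    and K: "\<And>x y. cinner (blinfun_apply K x) y = cinner x (blinfun_apply K y)" "norm K \<le> 1"
    and less: "\<And>x. x \<in> {-1<..<1} \<Longrightarrow> norm K * norm (F (of_real x)) < 1"
    and z: "z \<in> cut_plane"
  shows "\<exists>e>0. \<forall>h. e * norm h \<le> norm (blinfun_apply (id_blinfun - (K o\<^sub>L F z)) h)"
proof (cases "z \<in> \<real>")
  case True
  then obtain x where x: "z = of_real x" "x \<in> {-1<..<1}"
    using z by (auto elim!: Reals_cases simp: of_real_in_cut_plane_iff)
  have "(1 - norm K * norm (F z)) * norm h \<le> norm ((id_blinfun - (K o\<^sub>L F z)) h)" for h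
  proof -
    have "norm (K (F z h)) \<le> norm K * norm (F z) * norm h"
      using norm_blinfun[of K "F z h"] mult_left_mono[OF norm_blinfun[of "F z" h] norm_ge_zero[of K]]
      by (simp add: mult.assoc)
    then show ?thesis
      using norm_triangle_ineq2[of h "K (F z h)"] by (simp add: blinfun.diff_left algebra_simps)
  qed
  then show ?thesis
    using less[OF x(2)] x(1) by (intro exI[of _ "1 - norm K * norm (F z)"]) simp
next
  case False
  then have Im_z: "Im z \<noteq> 0"
    by (simp add: complex_is_Real_iff)
  have "((\<lambda>w. norm K * norm (F w)) \<longlongrightarrow> norm K * norm (F 0)) (at 0)"
    using RS_isCont[OF F, of 0] by (intro tendsto_mult tendsto_norm) (auto simp: cut_plane_iff isCont_def)
  then have "\<forall>\<^sub>F w in at 0. norm K * norm (F w) < 1"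
    by (rule order_tendstoD) (use less[of 0] in simp)
  then obtain d where d: "0 < d" "\<And>w. w \<noteq> 0 \<Longrightarrow> cmod w < d \<Longrightarrow> norm K * norm (F w) < 1"
    by (auto simp: eventually_at)
  \<comment> \<open>The sign puts \<open>w\<close> on the same side of the axis as \<open>z\<close>,
    as Schwarz-Pick requires, and \<open>d / 2\<close> keeps it inside the neighbourhood of
    0.\<close>
  define w where "w = Complex 0 (sgn (Im z) * (d / 2))"
  have "cmod w = d / 2" "w \<noteq> 0"
    using Im_z d by (auto simp: w_def complex_norm abs_mult abs_sgn_eq complex_eq_iff sgn_eq_0_iff)
  then have Kw: "norm K * norm (F w) < 1"
    using d by simp
  have zw: "0 < Im z * Im w"
    using Im_z d by (simp add: w_def abs_sgn[symmetric] flip: mult.assoc)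
  then have w: "w \<notin> \<real>"
    by (auto simp: complex_is_Real_iff)
  define C where "C = (cmod (z - cnj w))\<^sup>2 / (Im z * Im w)"
  \<comment> \<open>Writing the absolute value as \<open>sgn (Im z)\<close> times the imaginary part
    keeps the right side a quadratic form in \<open>h\<close>, as polarization needs.\<close>
  have "cmod (cinner ((F z - F w) h) h) \<le> C * sgn (Im z) * Im (cinner (F z h) h)" for h
  proof -
    interpret scalar_nevanlinna "\<lambda>z. cinner (F z h) h"
      by (rule RS_scalar_nevanlinna[OF F])
    have "\<bar>Im (cinner (F z h) h)\<bar> = sgn (Im z) * Im (cinner (F z h) h)"
      using pos[OF False] Im_z by (auto simp: sgn_if zero_le_mult_iff)
    then show ?thesis
      using norm_diff_le_Im_off_real_axis[OF hol_off_real sym pos zw]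
      by (simp add: blinfun.diff_left cinner_diff_left C_def)
  qed
  then show ?thesis
    using z w by (intro bounded_below_id_minus_compose[OF RS_clinear[OF F] RS_clinear[OF F, of w] K Kw])
      (auto simp: cut_plane_iff)
qed

text \<open>The adjoint has its factors in the opposite order, so its lower bound is derived from
  the one at \<open>cnj z\<close> by moving \<open>K\<close> across.\<close>

lemma RS_bounded_invertible:
  fixes K :: "'a::{complex_inner, complete_space} \<Rightarrow>\<^sub>L 'a"
  assumes F: "F \<in> RS" and lin: "clinear_op K"
    and K: "\<And>x y. cinner (blinfun_apply K x) y = cinner x (blinfun_apply K y)" "norm K \<le> 1"
    and less: "\<And>x. x \<in> {-1<..<1} \<Longrightarrow> norm K * norm (F (of_real x)) < 1"
    and z: "z \<in> cut_plane"
  shows "bounded_invertible (id_blinfun - (K o\<^sub>L F z))"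
proof -
  define G where "G = F (cnj z)"
  obtain a where a: "0 < a" "\<And>h. a * norm h \<le> norm (h - K (F z h))"
    using RS_bounded_below[OF F K less z] by (auto simp: blinfun.diff_left)
  obtain b where b: "0 < b" "\<And>h. b * norm h \<le> norm (h - K (G h))"
    using RS_bounded_below[OF F K less, of "cnj z"] z
    by (auto simp: blinfun.diff_left cnj_in_cut_plane_iff G_def)
  have adj: "cadjoint (id_blinfun - (K o\<^sub>L F z)) = id_blinfun - (G o\<^sub>L K)"
    using RS_cinner[OF F z]
    by (intro cadjoint_eqI) (simp add: blinfun.diff_left cinner_diff_left cinner_diff_right K(1) G_def)
  define c where "c = 1 / (1 + norm G / b)"
  have den: "0 < 1 + norm G / b"
    using b by (simp add: add_pos_nonneg)
  have c: "c * norm y \<le> norm (y - G (K y))" for y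
  proof -
    define v where "v = y - G (K y)"
    \<comment> \<open>\<open>K v\<close> equals \<open>K y - K (G (K y))\<close>, so the known lower
      bound applies to the vector \<open>K y\<close>. The vector \<open>y = v + G (K y)\<close> is
      then controlled too.\<close>
    have "b * norm (K y) \<le> norm (K v)"
      using b(2)[of "K y"] by (simp add: v_def blinfun.diff_right)
    also have "\<dots> \<le> norm v"
      using norm_blinfun[of K v] mult_right_mono[OF K(2) norm_ge_zero[of v]] by simp
    finally have Ky: "norm (K y) \<le> norm v / b"
      using b by (simp add: field_simps)
    have "norm y = norm (v + G (K y))"
      by (simp add: v_def)
    also have "\<dots> \<le> norm v + norm G * norm (K y)"
      using norm_triangle_ineq[of v "G (K y)"] norm_blinfun[of G "K y"] by linarith
    also have "\<dots> \<le> norm v + norm G * (norm v / b)"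
      using Ky by (intro add_left_mono mult_left_mono) auto
    also have "\<dots> = (1 + norm G / b) * norm v"
      by (simp add: field_simps)
    finally show ?thesis
      using den by (simp add: c_def v_def field_simps)
  qed
  have c_pos: "0 < c"
    using den by (simp add: c_def)
  show ?thesis
  proof (rule bounded_invertibleI[where c = "min a c"])
    show "clinear_op (id_blinfun - (K o\<^sub>L F z))"
      by (intro clinear_op_diff clinear_op_id clinear_op_compose lin RS_clinear[OF F z])
    show "min a c * norm x \<le> norm ((id_blinfun - (K o\<^sub>L F z)) x)" for x
      using order_trans[OF mult_right_mono[OF min.cobounded1 norm_ge_zero] a(2)]
      by (simp add: blinfun.diff_left)
    show "min a c * norm x \<le> norm (cadjoint (id_blinfun - (K o\<^sub>L F z)) x)" for x
      using order_trans[OF mult_right_mono[OF min.cobounded2 norm_ge_zero] c]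
      by (simp add: adj blinfun.diff_left)
  qed (use a c_pos in simp)
qed

section \<open>The transform\<close>

locale selfadjoint_contraction_block =
  fixes K11 :: "'m::{complex_inner, complete_space} \<Rightarrow>\<^sub>L 'm"
    and K12 :: "'h::{complex_inner, complete_space} \<Rightarrow>\<^sub>L 'm"
    and K22 :: "'h \<Rightarrow>\<^sub>L 'h"
  assumes lin: "clinear_op K11" "clinear_op K12" "clinear_op K22"
    and selfadj: "selfadjoint (block_op K11 K12 (cadjoint K12) K22)"
    and norm_block: "norm (block_op K11 K12 (cadjoint K12) K22) \<le> 1"
begin

lemma cinner_block:
  "cinner (K11 m + K12 g) m' + cinner (cadjoint K12 m + K22 g) g'
    = cinner m (K11 m' + K12 g') + cinner g (cadjoint K12 m' + K22 g')"
proof -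
  let ?B = "block_op K11 K12 (cadjoint K12) K22"
  have "clinear_op ?B"
    unfolding clinear_op_def
    by (auto simp: block_op_apply scaleC_prod_def scaleC_add_right lin[THEN clinear_opD]
        clinear_opD[OF clinear_op_cadjoint[OF lin(2)]])
  from cadjoint_cinner[OF this, of "(m, g)" "(m', g')"] show ?thesis
    using selfadj by (simp add: selfadjoint_def block_op_apply cinner_prod_def)
qed

lemma norm_block_le:
  "(norm (K11 m + K12 g))\<^sup>2 + (norm (cadjoint K12 m + K22 g))\<^sup>2 \<le> (norm m)\<^sup>2 + (norm g)\<^sup>2"
proof -
  let ?B = "block_op K11 K12 (cadjoint K12) K22"
  have "norm (?B (m, g)) \<le> norm (m, g)"
    using norm_blinfun[of ?B "(m, g)"] mult_right_mono[OF norm_block norm_ge_zero[of "(m, g)"]] by simp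
  then show ?thesis
    by (simp add: block_op_apply norm_prod_def)
qed

lemma K22_symmetric: "cinner (K22 x) y = cinner x (K22 y)"
  using cinner_block[of 0 x 0 y] by (simp add: blinfun.zero_right cinner_zero_left cinner_zero_right)

lemma norm_K22_le: "norm K22 \<le> 1"
proof (rule norm_blinfun_bound)
  fix g
  have "(norm (K12 g))\<^sup>2 + (norm (K22 g))\<^sup>2 \<le> (norm g)\<^sup>2"
    using norm_block_le[of 0 g] by (simp add: blinfun.zero_right)
  then have "(norm (K22 g))\<^sup>2 \<le> (norm g)\<^sup>2"
    using zero_le_power2[of "norm (K12 g)"] by linarith
  then have "norm (K22 g) \<le> norm g"
    by (rule power2_le_imp_le) simp
  then show "norm (K22 g) \<le> 1 * norm g"
    by simp
qed simp

section \<open>The transform under the strict bound on (-1, 1) shared by both cases\<close>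

context
  fixes F :: "complex \<Rightarrow> 'h \<Rightarrow>\<^sub>L 'h"
  assumes F: "F \<in> RS"
    and less: "\<And>x. x \<in> {-1<..<1} \<Longrightarrow> norm K22 * norm (F (of_real x)) < 1"
begin

lemma bounded_invertible_id_minus: "z \<in> cut_plane \<Longrightarrow> bounded_invertible (id_blinfun - (K22 o\<^sub>L F z))"
  by (rule RS_bounded_invertible[OF F lin(3) K22_symmetric norm_K22_le less])

text \<open>This is the vector \<open>h z\<close> at which the feedback loop through
  \<open>F z\<close> closes: the block operator takes \<open>(m, F z (state z m))\<close> to the
  pair of \<open>Theta_transform\<close> at \<open>m\<close> and \<open>state z m\<close>.\<close>

definition state :: "complex \<Rightarrow> 'm \<Rightarrow>\<^sub>L 'h" where
  "state z = op_inverse (id_blinfun - (K22 o\<^sub>L F z)) o\<^sub>L cadjoint K12"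

abbreviation "\<Theta> \<equiv> Theta_transform K11 K12 K22 F"

lemma Theta_apply: "\<Theta> z m = K11 m + K12 (F z (state z m))"
  by (simp add: Theta_transform_def state_def blinfun.add_left)

lemma state_eq:
  assumes "z \<in> cut_plane"
  shows "cadjoint K12 m + K22 (F z (state z m)) = state z m"
proof -
  have "(id_blinfun - (K22 o\<^sub>L F z)) o\<^sub>L op_inverse (id_blinfun - (K22 o\<^sub>L F z)) = id_blinfun"
    using is_op_inverse_op_inverse[OF bounded_invertible_id_minus[OF assms]] by (simp add: is_op_inverse_def)
  from arg_cong[OF this, of "\<lambda>A. A (cadjoint K12 m)"] show ?thesis
    by (simp add: state_def blinfun.diff_left algebra_simps)
qed

lemma clinear_op_state: "z \<in> cut_plane \<Longrightarrow> clinear_op (state z)"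
  using is_op_inverse_op_inverse[OF bounded_invertible_id_minus]
  by (auto simp: state_def is_op_inverse_def intro!: clinear_op_compose clinear_op_cadjoint lin)

lemma clinear_op_Theta:
  assumes "z \<in> cut_plane"
  shows "clinear_op (\<Theta> z)"
proof -
  have "\<Theta> z = K11 + (K12 o\<^sub>L (F z o\<^sub>L state z))"
    by (rule blinfun_eqI) (simp add: Theta_apply blinfun.add_left)
  then show ?thesis
    using assms by (simp add: clinear_op_add clinear_op_compose lin clinear_op_state RS_clinear[OF F])
qed

text \<open>Symmetry of the block operator on two such closed loops. The choices
  \<open>w = cnj z\<close> and \<open>w = z\<close> give the symmetry and the imaginary part of the
  transform.\<close>

lemma cinner_Theta:
  assumes "z \<in> cut_plane" "w \<in> cut_plane"
  shows "cinner (\<Theta> z m) m' + cinner (state z m) (F w (state w m'))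
    = cinner m (\<Theta> w m') + cinner (F z (state z m)) (state w m')"
  using cinner_block[of m "F z (state z m)" m' "F w (state w m')"]
  by (simp only: Theta_apply state_eq assms)

lemma Theta_symmetric:
  assumes z: "z \<in> cut_plane"
  shows "cinner (\<Theta> z m) m' = cinner m (\<Theta> (cnj z) m')"
  using cinner_Theta[of z "cnj z" m m'] RS_cinner[OF F z] z by (simp add: cnj_in_cut_plane_iff)

text \<open>The increment of the transform is that of \<open>F\<close> between two states, one of
  them fixed at \<open>cnj z\<close>. Hence differentiability needs only continuity of
  \<open>state\<close>, not a derivative of the inverse.\<close>

lemma Theta_diff:
  assumes z: "z \<in> cut_plane" and w: "w \<in> cut_plane"
  shows "\<Theta> w - \<Theta> z = cadjoint (state (cnj z)) o\<^sub>L (F w - F z) o\<^sub>L state w"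
proof (rule blinfun_eqI, rule cinner_eqI)
  fix m m'
  have z': "cnj z \<in> cut_plane"
    using z by (simp add: cnj_in_cut_plane_iff)
  have "cinner ((\<Theta> w - \<Theta> z) m) m' = cinner ((F w - F z) (state w m)) (state (cnj z) m')"
    using cinner_Theta[OF w z', of m m'] Theta_symmetric[OF z, of m m']
      RS_cinner[OF F z, of "state w m" "state (cnj z) m'"]
    by (simp add: blinfun.diff_left cinner_diff_left algebra_simps)
  also have "\<dots> = cinner ((cadjoint (state (cnj z)) o\<^sub>L (F w - F z) o\<^sub>L state w) m) m'"
    by (simp add: cadjoint_cinner_left[OF clinear_op_state[OF z']])
  finally show "cinner m' ((\<Theta> w - \<Theta> z) m)
      = cinner m' ((cadjoint (state (cnj z)) o\<^sub>L (F w - F z) o\<^sub>L state w) m)"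
    by (simp only: cinner_commute[of m'])
qed

lemma state_tendsto:
  assumes z: "z \<in> cut_plane"
  shows "(state \<longlongrightarrow> state z) (at z)"
proof -
  note compose = bounded_bilinear.tendsto[OF bounded_bilinear_blinfun_compose]
  have "((\<lambda>w. id_blinfun - (K22 o\<^sub>L F w)) \<longlongrightarrow> id_blinfun - (K22 o\<^sub>L F z)) (at z)"
    using RS_isCont[OF F z] by (intro tendsto_diff tendsto_const compose) (simp add: isCont_def)
  moreover have "\<forall>\<^sub>F w in at z. bounded_invertible (id_blinfun - (K22 o\<^sub>L F w))"
    using eventually_at_in_open'[OF open_cut_plane z] by eventually_elim (rule bounded_invertible_id_minus)
  ultimately have "((\<lambda>w. op_inverse (id_blinfun - (K22 o\<^sub>L F w)))
      \<longlongrightarrow> op_inverse (id_blinfun - (K22 o\<^sub>L F z))) (at z)"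
    by (rule tendsto_op_inverse[where A = "\<lambda>w. id_blinfun - (K22 o\<^sub>L F w)"]) (rule bounded_invertible_id_minus[OF z])
  then show ?thesis
    unfolding state_def by (intro compose tendsto_const)
qed

lemma Theta_op_holomorphic: "op_holomorphic_on \<Theta> cut_plane"
  unfolding op_holomorphic_on_open_iff[OF open_cut_plane]
proof (intro ballI conjI)
  fix z
  assume z: "z \<in> cut_plane"
  show "clinear_op (\<Theta> z)"
    using z by (rule clinear_op_Theta)
  define X where "X = cadjoint (state (cnj z))"
  have X: "clinear_op X"
    using z unfolding X_def by (intro clinear_op_cadjoint clinear_op_state) (simp add: cnj_in_cut_plane_iff)
  note compose = bounded_bilinear.tendsto[OF bounded_bilinear_blinfun_compose]
  obtain D where "((\<lambda>w. (1 / (w - z)) *\<^sub>C (F w - F z)) \<longlongrightarrow> D) (at z)"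
    using RS_op_holomorphic[OF F] z by (auto simp: op_holomorphic_on_open_iff[OF open_cut_plane])
  then have "((\<lambda>w. X o\<^sub>L ((1 / (w - z)) *\<^sub>C (F w - F z)) o\<^sub>L state w) \<longlongrightarrow> X o\<^sub>L D o\<^sub>L state z) (at z)"
    by (rule compose[OF compose[OF tendsto_const] state_tendsto[OF z]])
  moreover have "\<forall>\<^sub>F w in at z. X o\<^sub>L ((1 / (w - z)) *\<^sub>C (F w - F z)) o\<^sub>L state w = (1 / (w - z)) *\<^sub>C (\<Theta> w - \<Theta> z)"
    using eventually_at_in_open'[OF open_cut_plane z]
  proof eventually_elim
    case (elim w)
    show ?case
      unfolding Theta_diff[OF z elim]
      by (rule blinfun_eqI) (simp add: scaleC_blinfun.rep_eq clinear_opD[OF X] X_def[symmetric])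
  qed
  ultimately have "((\<lambda>w. (1 / (w - z)) *\<^sub>C (\<Theta> w - \<Theta> z)) \<longlongrightarrow> X o\<^sub>L D o\<^sub>L state z) (at z)"
    by (rule Lim_transform_eventually)
  then show "\<exists>D. ((\<lambda>w. (1 / (w - z)) *\<^sub>C (\<Theta> w - \<Theta> z)) \<longlongrightarrow> D) (at z)"
    by blast
qed

lemma Theta_in_RS: "\<Theta> \<in> RS"
proof (rule RS_I)
  show "op_holomorphic_on \<Theta> cut_plane"
    by (rule Theta_op_holomorphic)
  show "cinner (\<Theta> z m) m' = cinner m (\<Theta> (cnj z) m')" if "z \<in> cut_plane" for z m m'
    using that by (rule Theta_symmetric)
next
  fix z :: complex and m
  assume z: "z \<notin> \<real>"
  then have z': "z \<in> cut_plane"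
    by (simp add: cut_plane_iff)
  define h where "h = state z m"
  \<comment> \<open>Each side contains a form and the conjugate of the other one, so the imaginary
    part of the form of the transform at \<open>m\<close> equals that of \<open>F z\<close> at
    \<open>h\<close>.\<close>
  have "Im (cinner (\<Theta> z m) m) + Im (cinner h (F z h)) = Im (cinner m (\<Theta> z m)) + Im (cinner (F z h) h)"
    using arg_cong[OF cinner_Theta[OF z' z', of m m], of Im] by (simp add: h_def)
  moreover have "Im (cinner m (\<Theta> z m)) = - Im (cinner (\<Theta> z m) m)" "Im (cinner h (F z h)) = - Im (cinner (F z h) h)"
    by (subst cinner_commute, simp)+
  ultimately have "Im (cinner (\<Theta> z m) m) = Im (cinner (F z h) h)"
    by simp
  then show "0 \<le> Im z * Im (cinner (\<Theta> z m) m)"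
    using RS_Im[OF F z] by simp
next
  fix x :: real
  assume x: "x \<in> {-1<..<1}"
  show "norm (\<Theta> (of_real x)) \<le> 1"
  proof (rule norm_blinfun_bound)
    fix m
    define h where "h = state (of_real x) m"
    have z: "of_real x \<in> cut_plane"
      using x by (simp add: of_real_in_cut_plane_iff)
    \<comment> \<open>Contractivity at the closed loop. Since \<open>F\<close> is a contraction at
      \<open>of_real x\<close>, the norms of \<open>h\<close> and its image cancel in the right
      direction.\<close>
    have "(norm (\<Theta> (of_real x) m))\<^sup>2 + (norm h)\<^sup>2 \<le> (norm m)\<^sup>2 + (norm (F (of_real x) h))\<^sup>2"
      using norm_block_le[of m "F (of_real x) h"] state_eq[OF z, of m] by (simp add: Theta_apply h_def)
    moreover have "norm (F (of_real x) h) \<le> norm h"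
      using norm_blinfun[of "F (of_real x)" h] mult_right_mono[OF RS_norm_le[OF F x] norm_ge_zero[of h]]
      by simp
    then have "(norm (F (of_real x) h))\<^sup>2 \<le> (norm h)\<^sup>2"
      by (rule power_mono) simp
    ultimately have "(norm (\<Theta> (of_real x) m))\<^sup>2 \<le> (norm m)\<^sup>2"
      by linarith
    then have "norm (\<Theta> (of_real x) m) \<le> norm m"
      by (rule power2_le_imp_le) simp
    then show "norm (\<Theta> (of_real x) m) \<le> 1 * norm m"
      by simp
  qed simp
qed

end

end

theorem theorem6p8:
  fixes K11 :: "'m::separable_chilbert_space \<Rightarrow>\<^sub>L 'm"
    and K12 :: "'h::separable_chilbert_space \<Rightarrow>\<^sub>L 'm"
    and K22 :: "'h \<Rightarrow>\<^sub>L 'h"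
  assumes "clinear_op K11" and "clinear_op K12" and "clinear_op K22"
    and "selfadjoint (block_op K11 K12 (cadjoint K12) K22)"
    and "norm (block_op K11 K12 (cadjoint K12) K22) \<le> 1"
  shows "(norm K22 < 1 \<longrightarrow>
      (\<forall>\<Omega>\<in>RS. (\<forall>z\<in>cut_plane. bounded_invertible (id_blinfun - (K22 o\<^sub>L \<Omega> z))) \<and>
        Theta_transform K11 K12 K22 \<Omega> \<in> RS)) \<and>
    (\<forall>\<Omega>\<in>RS. \<Omega> 0 = 0 \<longrightarrow>
      (\<forall>z\<in>cut_plane. bounded_invertible (id_blinfun - (K22 o\<^sub>L \<Omega> z))) \<and>
        Theta_transform K11 K12 K22 \<Omega> \<in> RS)"
proof -
  interpret selfadjoint_contraction_block K11 K12 K22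
    using assms by unfold_locales
  \<comment> \<open>Both parts reduce to the strict bound on (-1, 1).\<close>
  have main: "(\<forall>z\<in>cut_plane. bounded_invertible (id_blinfun - (K22 o\<^sub>L \<Omega> z))) \<and>
      Theta_transform K11 K12 K22 \<Omega> \<in> RS"
    if "\<Omega> \<in> RS" and "\<And>x. x \<in> {-1<..<1} \<Longrightarrow> norm K22 * norm (\<Omega> (of_real x)) < 1" for \<Omega>
    using bounded_invertible_id_minus[OF that] Theta_in_RS[OF that] by blast
  have less_if_norm_less: "norm K22 * norm (\<Omega> (of_real x)) < 1"
    if "norm K22 < 1" "\<Omega> \<in> RS" "x \<in> {-1<..<1}" for \<Omega> :: "complex \<Rightarrow> 'h \<Rightarrow>\<^sub>L 'h" and x
    using mult_left_le[OF RS_norm_le[OF that(2,3)] norm_ge_zero[of K22]] that(1) by linarith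
  \<comment> \<open>Here \<open>K22\<close> may have norm 1, and the strictness comes from \<Omega>
    alone.\<close>
  have less_if_zero: "norm K22 * norm (\<Omega> (of_real x)) < 1"
    if "\<Omega> \<in> RS" "\<Omega> 0 = 0" "x \<in> {-1<..<1}" for \<Omega> :: "complex \<Rightarrow> 'h \<Rightarrow>\<^sub>L 'h" and x
    using mult_left_le_one_le[OF norm_ge_zero norm_ge_zero norm_K22_le, of "\<Omega> (of_real x)"]
      RS_norm_less[OF that] by linarith
  show ?thesis
  proof (rule conjI; intro impI ballI)
    fix \<Omega> :: "complex \<Rightarrow> 'h \<Rightarrow>\<^sub>L 'h"
    assume "norm K22 < 1" "\<Omega> \<in> RS"
    then show "(\<forall>z\<in>cut_plane. bounded_invertible (id_blinfun - (K22 o\<^sub>L \<Omega> z))) \<and>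
        Theta_transform K11 K12 K22 \<Omega> \<in> RS"
      by (intro main less_if_norm_less)
  next
    fix \<Omega> :: "complex \<Rightarrow> 'h \<Rightarrow>\<^sub>L 'h"
    assume "\<Omega> \<in> RS" "\<Omega> 0 = 0"
    then show "(\<forall>z\<in>cut_plane. bounded_invertible (id_blinfun - (K22 o\<^sub>L \<Omega> z))) \<and>
        Theta_transform K11 K12 K22 \<Omega> \<in> RS"
      by (intro main less_if_zero)
  qed
qed

end
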